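(* The $\star$-dual of the Penrose substitution is the Tübingen triangle substitution, and vice versa.
   Context: Identify $\mathbb{R}^2$ with $\mathbb{C}$; let $\xi=e^{2\pi i/5}$ and $\tau=\frac{1+\sqrt5}{2}$, so $\tau^{-1}=\xi+\xi^4$. Substitutions as function systems. A tile-substitution with factor $\tau$ inflates each tile by $\tau$ and dissects the result into isometric copies of the prototiles. Equivalently it is given by a function system $X_j=\bigcup_i\bigcup_{f\in F_{ij}}f(X_i)$, whose maps are isometries composed with the contraction $\tau^{-1}$, whose unique solution by nonempty compact sets $X_j$ gives the prototiles, and in which the pieces of each union have pairwise disjoint interiors. Only the way each prototile is dissected matters: where the prototiles are located in the plane, whether they overlap each other, and a common scaling of the prototiles are irrelevant. $\star$-dual. Let $\varphi$ be the automorphism of $\mathbb{Q}(\xi)$ with $\varphi(\xi)=\xi^3$. For $f$ of the form $x\mapsto\alpha x+\beta$ or $x\mapsto\alpha\overline{x}+\beta$ with $\alpha,\beta\in\mathbb{Q}(\xi)$, $\alpha\ne0$, let $f^\sharp$ be the map obtained from $f^{-1}$ by applying $\varphi$ to its coefficients. The $\star$-dual of the substitution given by $X_j=\bigcup_i\bigcup_{f\in F_{ij}}f(X_i)$ is the substitution given by $X_i^\star=\bigcup_j\bigcup_{f\in F_{ij}}f^\sharp(X_j^\star)$. Penrose substitution (version with two triangles as prototiles, $S$ acute and $L$ obtuse, substitution factor $\tau$). It is given by $$S=f_1(S)\cup f_2(L),\qquad L=f_3(L)\cup f_4(S)\cup f_5(L),$$ $$f_1(x)=(\xi+\xi^4)(-\xi^4)x-1-\xi^3,\quad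 f_2(x)=(\xi+\xi^4)(-\xi)x-1-\xi^3-\xi^4,\quad f_3(x)=(\xi+\xi^4)\xi^3x+1+\xi,$$ $$f_4(x)=(\xi+\xi^4)(-\xi^2)\overline{x}+1-\xi^3,\quad f_5(x)=(\xi+\xi^4)(-1)\overline{x}+1-\xi^2-\xi^3.$$ Its $\star$-dual is thus given by $S^\star=f_1^\sharp(S^\star)\cup f_4^\sharp(L^\star)$, $L^\star=f_2^\sharp(S^\star)\cup f_3^\sharp(L^\star)\cup f_5^\sharp(L^\star)$. Tübingen triangle substitution (factor $\tau$). Prototiles: an acute triangle with labelled vertices $(p,q,r)$, $|pq|=|pr|=\tau|qr|$, and an obtuse triangle with labelled vertices $(a,b,c)$, $|ac|=|bc|=|qr|$, $|ab|=\tau|qr|$. With $q'=p+\tau^{-1}(q-p)$ and $r'=p+\tau^{-1}(r-p)$, the acute triangle is dissected into the acute triangles $(p,r',q')$ and $(q,r,r')$ and the obtuse triangle $(r',q,q')$. With $s=a+\tau^{-2}(b-a)$, the obtuse triangle is dissected into the obtuse triangle $(c,a,s)$ and the acute triangle $(b,c,s)$. The order of the vertices tells how the labels are carried to the pieces. *)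

theory Defs
  imports "HOL-Analysis.Analysis"
begin

definition xi :: complex where
  "xi = exp (2 * of_real pi * \<i> / 5)"

definition tau :: real where
  "tau = (1 + sqrt 5) / 2"

text \<open>The field \<open>\<rat>(\<xi>)\<close>, as the least subfield of the complex numbers containing \<open>\<xi>\<close>.\<close>

inductive_set Q_xi :: "complex set" where
  xi: "xi \<in> Q_xi"
| one: "1 \<in> Q_xi"
| diff: "x \<in> Q_xi \<Longrightarrow> y \<in> Q_xi \<Longrightarrow> x - y \<in> Q_xi"
| mult: "x \<in> Q_xi \<Longrightarrow> y \<in> Q_xi \<Longrightarrow> x * y \<in> Q_xi"
| inverse: "x \<in> Q_xi \<Longrightarrow> x \<noteq> 0 \<Longrightarrow> inverse x \<in> Q_xi"

text \<open>The automorphism \<open>\<phi>\<close> of \<open>\<rat>(\<xi>)\<close> with \<open>\<phi>(\<xi>) = \<xi>\<^sup>3\<close>. The condition \<open>extensional\<close> only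
  fixes a junk value outside \<open>\<rat>(\<xi>)\<close>, to make the description unique.\<close>

definition field_automorphism :: "complex set \<Rightarrow> (complex \<Rightarrow> complex) \<Rightarrow> bool" where
  "field_automorphism K h \<longleftrightarrow> bij_betw h K K \<and>
     (\<forall>x\<in>K. \<forall>y\<in>K. h (x + y) = h x + h y \<and> h (x * y) = h x * h y)"

definition star_aut :: "complex \<Rightarrow> complex" where
  "star_aut = (THE h. field_automorphism Q_xi h \<and> h xi = xi ^ 3 \<and> h \<in> extensional Q_xi)"

text \<open>\<open>x \<mapsto> \<alpha> x + \<beta>\<close> for \<open>c = False\<close>, and \<open>x \<mapsto> \<alpha> (cnj x) + \<beta>\<close> for \<open>c = True\<close>.\<close>

definition sim_map :: "bool \<Rightarrow> complex \<Rightarrow> complex \<Rightarrow> complex \<Rightarrow> complex" where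
  "sim_map c \<alpha> \<beta> x = \<alpha> * (if c then cnj x else x) + \<beta>"

text \<open>\<open>f\<^sup>\<sharp>\<close> is the inverse of \<open>f\<close> with \<open>\<phi>\<close> applied to its coefficients; the coefficients (and \<open>c\<close>) are
  determined by the map because \<open>\<alpha> \<noteq> 0\<close>.\<close>

definition sharp :: "(complex \<Rightarrow> complex) \<Rightarrow> complex \<Rightarrow> complex" where
  "sharp f = (THE g. \<exists>c \<alpha> \<beta>. \<alpha> \<noteq> 0 \<and> inv f = sim_map c \<alpha> \<beta> \<and>
     g = sim_map c (star_aut \<alpha>) (star_aut \<beta>))"

definition similarity :: "real \<Rightarrow> (complex \<Rightarrow> complex) \<Rightarrow> bool" where
  "similarity s f \<longleftrightarrow> (\<forall>x y. dist (f x) (f y) = s * dist x y)"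

text \<open>The two prototiles, named by their areas. For the Penrose substitution \<open>Small\<close> is the acute
  triangle \<open>S\<close> and \<open>Large\<close> the obtuse triangle \<open>L\<close>; for the Tuebingen triangle substitution
  \<open>Small\<close> is the obtuse and \<open>Large\<close> the acute triangle.\<close>

datatype tile = Small | Large

text \<open>\<open>F i j\<close> is the set \<open>F\<^sub>i\<^sub>j\<close> of the maps that place copies of tile \<open>i\<close> in tile \<open>j\<close>.\<close>

type_synonym function_system = "tile \<Rightarrow> tile \<Rightarrow> (complex \<Rightarrow> complex) set"

definition solution :: "function_system \<Rightarrow> (tile \<Rightarrow> complex set) \<Rightarrow> bool" where
  "solution F X \<longleftrightarrow>
     (\<forall>j. compact (X j) \<and> X j \<noteq> {} \<and> X j = (\<Union>i. \<Union>f\<in>F i j. f ` X i))"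

text \<open>\<open>F\<close> gives a tile-substitution with factor \<open>\<tau>\<close> and prototiles \<open>X\<close>.\<close>

definition tile_substitution :: "function_system \<Rightarrow> (tile \<Rightarrow> complex set) \<Rightarrow> bool" where
  "tile_substitution F X \<longleftrightarrow>
     (\<forall>i j. finite (F i j) \<and> (\<forall>f\<in>F i j. similarity (1 / tau) f)) \<and>
     solution F X \<and> (\<forall>Y. solution F Y \<longrightarrow> Y = X) \<and>
     (\<forall>j i i' f f'. f \<in> F i j \<longrightarrow> f' \<in> F i' j \<longrightarrow> (i, f) \<noteq> (i', f') \<longrightarrow>
        interior (f ` X i) \<inter> interior (f' ` X i') = {})"

text \<open>Two function systems describe the same substitution if they differ only by the location
  of each prototile in the plane and by a common scaling \<open>s\<close> of the prototiles.\<close>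

definition same_substitution :: "function_system \<Rightarrow> function_system \<Rightarrow> bool" where
  "same_substitution F G \<longleftrightarrow> (\<exists>s>0. \<exists>g. (\<forall>i. similarity s (g i)) \<and>
     (\<forall>i j. G i j = (\<lambda>f. g j \<circ> f \<circ> inv (g i)) ` F i j))"

definition over_Q_xi :: "function_system \<Rightarrow> bool" where
  "over_Q_xi F \<longleftrightarrow> (\<forall>i j. \<forall>f\<in>F i j.
     \<exists>c. \<exists>\<alpha>\<in>Q_xi. \<exists>\<beta>\<in>Q_xi. \<alpha> \<noteq> 0 \<and> f = sim_map c \<alpha> \<beta>)"

definition dual_system :: "function_system \<Rightarrow> function_system" where
  "dual_system F i j = sharp ` F j i"

text \<open>A substitution is represented by the set of all function systems that give it. Its
  \<open>\<star>\<close>-dual collects what is obtained from all of its representatives with coefficients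
  in \<open>\<rat>(\<xi>)\<close>.\<close>

definition star_dual :: "function_system set \<Rightarrow> function_system set" where
  "star_dual \<S> = {G. \<exists>F\<in>\<S>. over_Q_xi F \<and> same_substitution (dual_system F) G}"

definition f1 :: "complex \<Rightarrow> complex" where
  "f1 = sim_map False ((xi + xi^4) * (- (xi^4))) (- 1 - xi^3)"

definition f2 :: "complex \<Rightarrow> complex" where
  "f2 = sim_map False ((xi + xi^4) * (- xi)) (- 1 - xi^3 - xi^4)"

definition f3 :: "complex \<Rightarrow> complex" where
  "f3 = sim_map False ((xi + xi^4) * xi^3) (1 + xi)"

definition f4 :: "complex \<Rightarrow> complex" where
  "f4 = sim_map True ((xi + xi^4) * (- (xi^2))) (1 - xi^3)"

definition f5 :: "complex \<Rightarrow> complex" where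
  "f5 = sim_map True ((xi + xi^4) * (- 1)) (1 - xi^2 - xi^3)"

fun penrose_system :: function_system where
  "penrose_system Small Small = {f1}"
| "penrose_system Large Small = {f2}"
| "penrose_system Large Large = {f3, f5}"
| "penrose_system Small Large = {f4}"

definition penrose :: "function_system set" where
  "penrose = {F. same_substitution penrose_system F \<and> (\<exists>X. tile_substitution F X)}"

text \<open>\<open>acute p q r\<close> and \<open>obtuse a b c\<close> describe the labelled prototiles of the Tuebingen
  triangle substitution up to scaling.\<close>

definition acute :: "complex \<Rightarrow> complex \<Rightarrow> complex \<Rightarrow> bool" where
  "acute p q r \<longleftrightarrow> q \<noteq> r \<and> dist p q = tau * dist q r \<and> dist p r = tau * dist q r"

definition obtuse :: "complex \<Rightarrow> complex \<Rightarrow> complex \<Rightarrow> bool" where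
  "obtuse a b c \<longleftrightarrow> a \<noteq> c \<and> dist b c = dist a c \<and> dist a b = tau * dist a c"

text \<open>The map carrying the labelled triangle \<open>(u, v, w)\<close> to the labelled piece \<open>(u', v', w')\<close>,
  as a singleton set.\<close>

definition carry :: "complex \<Rightarrow> complex \<Rightarrow> complex \<Rightarrow> complex \<Rightarrow> complex \<Rightarrow> complex \<Rightarrow>
    (complex \<Rightarrow> complex) set" where
  "carry u v w u' v' w' = {f. similarity (1 / tau) f \<and> f u = u' \<and> f v = v' \<and> f w = w'}"

fun tuebingen_system ::
    "complex \<Rightarrow> complex \<Rightarrow> complex \<Rightarrow> complex \<Rightarrow> complex \<Rightarrow> complex \<Rightarrow> function_system" where
  "tuebingen_system p q r a b c Large Large =
     (let q' = p + of_real (1 / tau) * (q - p); r' = p + of_real (1 / tau) * (r - p)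
      in carry p q r p r' q' \<union> carry p q r q r r')"
| "tuebingen_system p q r a b c Small Large =
     (let q' = p + of_real (1 / tau) * (q - p); r' = p + of_real (1 / tau) * (r - p)
      in carry a b c r' q q')"
| "tuebingen_system p q r a b c Small Small =
     (let s = a + of_real (1 / tau^2) * (b - a) in carry a b c c a s)"
| "tuebingen_system p q r a b c Large Small =
     (let s = a + of_real (1 / tau^2) * (b - a) in carry p q r b c s)"

fun tuebingen_tiles ::
    "complex \<Rightarrow> complex \<Rightarrow> complex \<Rightarrow> complex \<Rightarrow> complex \<Rightarrow> complex \<Rightarrow> tile \<Rightarrow> complex set" where
  "tuebingen_tiles p q r a b c Large = convex hull {p, q, r}"
| "tuebingen_tiles p q r a b c Small = convex hull {a, b, c}"

definition tuebingen :: "function_system set" where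
  "tuebingen = {F. \<exists>p q r a b c. acute p q r \<and> obtuse a b c \<and> dist a c = dist q r \<and>
     F = tuebingen_system p q r a b c \<and> tile_substitution F (tuebingen_tiles p q r a b c)}"

end

theory Submission
  imports Defs
begin

text \<open>Applying \<open>\<phi>\<close> to coefficients commutes with composition and inversion of the maps with
  coefficients in \<open>\<rat>(\<xi>)\<close>, because \<open>\<phi>\<close> commutes with complex conjugation. A system over \<open>\<rat>(\<xi>)\<close> that is
  obtained from the Penrose system by moving the prototiles can only be obtained by moves that are
  themselves over \<open>\<rat>(\<xi>)\<close>, since they map fixed points to fixed points; hence all representatives of the
  substitution have equivalent duals. The dual of the given Penrose system, with its prototiles cut at
  explicit points of \<open>\<rat>(\<xi>)\<close>, is a Tuebingen system. Finally \<open>\<phi> \<circ> \<phi>\<close> is complex conjugation, so the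
  second dual is the mirror image of the original system, which is the same substitution.\<close>

section \<open>The field of fifth roots of unity and its automorphism\<close>

text \<open>The automorphism turns the contraction ratio \<open>1 / tau\<close> into
  \<open>- tau\<close>, so conjugating the coefficients alone gives expanding maps; the inversion in
  \<open>sharp\<close> makes them contract by \<open>1 / tau\<close> again, but it also reverses
  composition, which is why the dual exchanges source and target tile. The main obstacle is that
  representatives may be moved by arbitrary real similarities, whose coefficients need not lie in
  the field, while the dual is only meaningful over the field. Moreover the automorphism does not
  preserve moduli, so it is not evident that a common scaling of the two prototiles stays common;
  what survives is equality of moduli, because squared moduli lie in the field. The geometric side
  is reduced to finite checks: a similarity is pinned down by the images of three non-collinear
  points, so comparing maps means evaluating them at vertices, where everything is an identity
  modulo the fifth cyclotomic polynomial.\<close>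

lemma xi_eq_cis: "xi = cis (2 * pi / 5)"
  by (simp add: xi_def cis_conv_exp mult_ac)

lemma xi_pow_5: "xi ^ 5 = 1"
proof -
  have "xi ^ 5 = cis (2 * pi)"
    unfolding xi_eq_cis Complex.DeMoivre by simp
  then show ?thesis by simp
qed

lemma Im_xi_pos: "Im xi > 0"
  unfolding xi_eq_cis by (simp add: sin_gt_zero)

lemma xi_cyclotomic: "1 + xi + xi^2 + xi^3 + xi^4 = 0"
proof -
  have "xi \<noteq> 1" using Im_xi_pos by auto
  moreover have "(xi - 1) * (1 + xi + xi^2 + xi^3 + xi^4) = 0"
    using xi_pow_5 by algebra
  ultimately show ?thesis by simp
qed

lemma cnj_xi: "cnj xi = xi ^ 4"
proof -
  have "xi * cnj xi = 1"
    by (simp add: xi_eq_cis cis_cnj cis_mult)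
  moreover have "xi * xi ^ 4 = 1"
    using xi_pow_5 by (simp add: eval_nat_numeral)
  moreover have "xi \<noteq> 0" using Im_xi_pos by auto
  ultimately show ?thesis by (metis mult_left_cancel)
qed

lemma tau_pos: "tau > 0"
  unfolding tau_def by (simp add: add_pos_nonneg)

lemma tau_square: "tau\<^sup>2 = tau + 1"
  by (simp add: tau_def power2_eq_square field_simps)

lemma tau_gt_1: "tau > 1"
  by (simp add: tau_def)

lemma inverse_tau: "1 / tau = tau - 1"
  using tau_square tau_pos by (simp add: power2_eq_square field_simps)

lemma of_real_inverse_tau: "complex_of_real (1 / tau) = xi + xi ^ 4"
proof -
  define t where "t = Re (xi + xi ^ 4)"
  have re: "xi + xi ^ 4 = of_real t"
    unfolding t_def cnj_xi [symmetric] by (simp add: complex_eq_iff)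
  have "(xi + xi ^ 4)^2 + (xi + xi ^ 4) = 1"
    using xi_cyclotomic by algebra
  then have "complex_of_real (t^2 + t) = of_real 1" unfolding re by simp
  then have eq: "t\<^sup>2 + t = 1" by (simp only: of_real_eq_iff)
  \<comment> \<open>Positivity selects the root: \<open>t\<^sup>2 + t = 1\<close> has the solutions
    \<open>tau - 1\<close> and \<open>- tau\<close>.\<close>
  have "t = 2 * cos (2 * pi / 5)"
    unfolding t_def cnj_xi [symmetric] by (simp add: xi_eq_cis)
  moreover have "cos (2 * pi / 5) > 0" by (intro cos_gt_zero) auto
  ultimately have "t > 0" by simp
  have "(t - (tau - 1)) * (t + tau) = 0"
    using eq tau_square by (simp add: algebra_simps power2_eq_square)
  with \<open>t > 0\<close> tau_pos have "t = tau - 1" by auto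
  with re show ?thesis by (simp add: inverse_tau)
qed

lemma tau_irrational: "tau \<notin> \<rat>"
proof
  assume "tau \<in> \<rat>"
  then have "2 * tau - 1 \<in> \<rat>" by simp
  also have "2 * tau - 1 = sqrt 5" by (simp add: tau_def field_simps)
  finally have "sqrt 5 \<in> \<rat>" .
  then have "sqrt 5 \<in> \<int>" by (intro rational_algebraic_int_is_int algebraic_int_sqrt) auto
  moreover have "2 < sqrt 5" "sqrt 5 < 3" by (simp_all add: real_less_lsqrt real_less_rsqrt)
  ultimately show False by (elim Ints_cases) auto
qed

section \<open>Coordinates over the rationals in the powers of \<open>xi\<close>\<close>

definition cyc :: "rat \<Rightarrow> rat \<Rightarrow> rat \<Rightarrow> rat \<Rightarrow> complex \<Rightarrow> complex" where
  "cyc a b c d z = of_rat a + of_rat b * z + of_rat c * z^2 + of_rat d * z^3"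

lemma complex_of_rat_eq: "complex_of_rat x = of_real (of_rat x)"
  by (cases x) (simp add: of_rat_rat)

text \<open>The tower of quadratic extensions from the rationals through the real field generated by
  \<open>tau\<close> replaces irreducibility of the cyclotomic polynomial. As \<open>xi\<close> and
  its conjugate have sum \<open>t\<close> and product 1, \<open>xi\<close> is a root of a real
  quadratic; taking imaginary parts separates the two real coordinates, and irrationality of
  \<open>t\<close> then separates the rational ones.\<close>

lemma cyc_xi_eq_0:
  assumes "cyc a b c d xi = 0"
  shows "a = 0 \<and> b = 0 \<and> c = 0 \<and> d = 0"
proof -
  define t where "t = 1 / tau"
  have t: "xi + xi ^ 4 = of_real t" unfolding t_def using of_real_inverse_tau by simp
  have x2: "xi^2 = of_real t * xi - 1" and x3: "xi^3 = - of_real t * xi - of_real t"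
    unfolding t [symmetric] using xi_cyclotomic by algebra+
  have eq: "of_real (of_rat a - of_rat c - of_rat d * t) +
      of_real (of_rat b + (of_rat c - of_rat d) * t) * xi = 0"
    using assms unfolding cyc_def x2 x3 complex_of_rat_eq by (simp add: algebra_simps)
  from arg_cong [OF eq, of Im] Im_xi_pos have e1: "of_rat b + (of_rat c - of_rat d) * t = 0" by simp
  with eq have e2: "of_rat a - of_rat c - of_rat d * t = 0"
    by (metis add_0_right mult_zero_left of_real_0 of_real_eq_0_iff)
  have irr: "t \<notin> \<rat>" using tau_irrational unfolding t_def
    by (metis Rats_inverse inverse_eq_divide inverse_inverse_eq)
  have lin: "v = 0" if "of_rat u + of_rat v * t = 0" for u v
  proof (rule ccontr)
    assume "v \<noteq> 0"
    with that have "t = - of_rat u / of_rat v" by (simp add: field_simps add_eq_0_iff)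
    then have "t = of_rat (- u / v)" by (simp add: of_rat_divide of_rat_minus)
    with irr show False by simp
  qed
  have "- d = 0" using e2 by (intro lin [of "a - c" "- d"]) (simp add: of_rat_diff of_rat_minus)
  moreover have "c - d = 0" using e1 by (intro lin [of b "c - d"]) (simp add: of_rat_diff)
  ultimately show ?thesis using e1 e2 by simp
qed

lemma cyc_diff: "cyc a b c d z - cyc a' b' c' d' z = cyc (a - a') (b - b') (c - c') (d - d') z"
  by (simp add: cyc_def of_rat_diff algebra_simps)

lemma cyc_add: "cyc a b c d z + cyc a' b' c' d' z = cyc (a + a') (b + b') (c + c') (d + d') z"
  by (simp add: cyc_def of_rat_add algebra_simps)

text \<open>The coefficient of \<open>z^4\<close> is spread over the lower powers with a minus sign,
  and those of \<open>z^5\<close> and \<open>z^6\<close> fall on 1 and \<open>z\<close>. Keeping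
  \<open>z\<close> an arbitrary root lets the same formula serve \<open>xi\<close> and
  \<open>xi^3\<close>, which is exactly multiplicativity of \<open>frob\<close>.\<close>

lemma cyc_mult:
  assumes "1 + z + z^2 + z^3 + z^4 = 0"
  shows "cyc a b c d z * cyc a' b' c' d' z =
    cyc (a*a' - (b*d'+c*c'+d*b') + (c*d'+d*c')) (a*b'+b*a' - (b*d'+c*c'+d*b') + d*d')
        (a*c'+b*b'+c*a' - (b*d'+c*c'+d*b')) (a*d'+b*c'+c*b'+d*a' - (b*d'+c*c'+d*b')) z"
  unfolding cyc_def of_rat_add of_rat_diff of_rat_mult using assms by algebra

lemma cyc_xi_inj:
  assumes "cyc a b c d xi = cyc a' b' c' d' xi"
  shows "a = a' \<and> b = b' \<and> c = c' \<and> d = d'"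
proof -
  from assms have "cyc (a - a') (b - b') (c - c') (d - d') xi = 0"
    by (simp add: cyc_diff [symmetric])
  from cyc_xi_eq_0 [OF this] show ?thesis by simp
qed

definition cyc_field :: "complex set" where "cyc_field = {z. \<exists>a b c d. z = cyc a b c d xi}"

text \<open>The explicit candidate for the automorphism: same rational coordinates,
  \<open>xi\<close> replaced by \<open>xi^3\<close>. Linear independence makes the description
  definite on \<open>cyc_field\<close>.\<close>

definition frob :: "complex \<Rightarrow> complex" where
  "frob z = (THE w. \<exists>a b c d. z = cyc a b c d xi \<and> w = cyc a b c d (xi^3))"

lemma cyc_in_cyc_field: "cyc a b c d xi \<in> cyc_field"
  by (auto simp: cyc_field_def)

lemma cyc_field_cases:
  assumes "z \<in> cyc_field"
  obtains a b c d where "z = cyc a b c d xi"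
  using assms by (auto simp: cyc_field_def)

lemma frob_cyc: "frob (cyc a b c d xi) = cyc a b c d (xi^3)"
  unfolding frob_def
proof (rule the_equality)
  fix w assume "\<exists>a' b' c' d'. cyc a b c d xi = cyc a' b' c' d' xi \<and> w = cyc a' b' c' d' (xi ^ 3)"
  then show "w = cyc a b c d (xi ^ 3)" using cyc_xi_inj by blast
qed blast

lemma xi_cubed_cyclotomic: "1 + xi^3 + (xi^3)^2 + (xi^3)^3 + (xi^3)^4 = 0"
  using xi_cyclotomic by algebra

lemma cyc_xi_cubed: "cyc a b c d (xi^3) = cyc (a - d) (c - d) (- d) (b - d) xi"
  unfolding cyc_def of_rat_diff of_rat_minus using xi_cyclotomic by algebra

lemma frob_in_cyc_field: "z \<in> cyc_field \<Longrightarrow> frob z \<in> cyc_field"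
  by (elim cyc_field_cases) (simp add: frob_cyc cyc_xi_cubed cyc_in_cyc_field)

lemma cyc_field_add: "z \<in> cyc_field \<Longrightarrow> w \<in> cyc_field \<Longrightarrow> z + w \<in> cyc_field"
  by (elim cyc_field_cases) (simp add: cyc_add cyc_in_cyc_field)

lemma cyc_field_diff: "z \<in> cyc_field \<Longrightarrow> w \<in> cyc_field \<Longrightarrow> z - w \<in> cyc_field"
  by (elim cyc_field_cases) (simp add: cyc_diff cyc_in_cyc_field)

lemma cyc_field_mult: "z \<in> cyc_field \<Longrightarrow> w \<in> cyc_field \<Longrightarrow> z * w \<in> cyc_field"
  by (elim cyc_field_cases) (simp only: cyc_mult [OF xi_cyclotomic] cyc_in_cyc_field)

lemma frob_add: "z \<in> cyc_field \<Longrightarrow> w \<in> cyc_field \<Longrightarrow> frob (z + w) = frob z + frob w"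
  by (elim cyc_field_cases) (simp add: cyc_add frob_cyc)

lemma frob_mult: "z \<in> cyc_field \<Longrightarrow> w \<in> cyc_field \<Longrightarrow> frob (z * w) = frob z * frob w"
  by (elim cyc_field_cases)
    (simp only: cyc_mult [OF xi_cyclotomic] cyc_mult [OF xi_cubed_cyclotomic] frob_cyc)

text \<open>The exponent 3 squares to 9, which is 4 modulo 5, and \<open>xi^4\<close> is the
  conjugate of \<open>xi\<close>. So the automorphism has order four and conjugation is one of its
  powers.\<close>

lemma frob_frob: "z \<in> cyc_field \<Longrightarrow> frob (frob z) = cnj z"
proof (elim cyc_field_cases)
  fix a b c d assume z: "z = cyc a b c d xi"
  have "cyc (a - d) (c - d) (- d) (b - d) (xi^3) = cyc a b c d (xi^4)"
    unfolding cyc_def of_rat_diff of_rat_minus using xi_cyclotomic by algebra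
  moreover have "cnj (cyc a b c d xi) = cyc a b c d (xi^4)"
    by (simp add: cyc_def cnj_xi complex_of_rat_eq)
  ultimately show ?thesis by (simp add: z frob_cyc cyc_xi_cubed)
qed

lemma cyc_field_rat: "of_rat a \<in> cyc_field"
  using cyc_in_cyc_field [of a 0 0 0] by (simp add: cyc_def)

text \<open>The product of all four conjugates of \<open>z\<close> is fixed by \<open>frob\<close>, hence rational.\<close>

lemma cyc_field_inverse:
  assumes "z \<in> cyc_field" "z \<noteq> 0"
  shows "inverse z \<in> cyc_field"
proof -
  let ?w = "frob z * cnj z * frob (cnj z)"
  have in_cyc_field: "frob z \<in> cyc_field" "cnj z \<in> cyc_field" "frob (cnj z) \<in> cyc_field" "z \<in> cyc_field"
    using assms frob_in_cyc_field frob_frob by metis+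
  have 0: "frob 0 = 0" using frob_cyc [of 0 0 0 0] by (simp add: cyc_def)
  have ne: "frob y \<noteq> 0" if "y \<in> cyc_field" "y \<noteq> 0" for y
    using frob_frob [OF that(1)] that(2) 0 by auto
  have "?w \<in> cyc_field" using in_cyc_field by (intro cyc_field_mult)
  have zw: "z * ?w \<in> cyc_field" using in_cyc_field by (intro cyc_field_mult)
  have "frob (z * ?w) = frob z * (frob (frob z) * frob (cnj z) * frob (frob (cnj z)))"
    using in_cyc_field by (simp add: frob_mult cyc_field_mult)
  also have "\<dots> = z * ?w" using in_cyc_field by (simp add: frob_frob mult_ac)
  finally have fix_: "frob (z * ?w) = z * ?w" .
  obtain a b c d where e: "z * ?w = cyc a b c d xi" using zw by (elim cyc_field_cases)
  have "cyc (a - d) (c - d) (- d) (b - d) xi = cyc a b c d xi"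
    using fix_ unfolding e frob_cyc cyc_xi_cubed .
  from cyc_xi_inj [OF this] have "b = 0" "c = 0" "d = 0" by auto
  with e have e': "z * ?w = of_rat a" by (simp add: cyc_def)
  have "z * ?w \<noteq> 0" using ne assms in_cyc_field by simp
  with e' have "of_rat a \<noteq> (0 :: complex)" by simp
  then have "z * (?w * of_rat (inverse a)) = 1"
    unfolding of_rat_inverse mult.assoc [symmetric]
    by (metis e' mult.assoc right_inverse)
  then have "inverse z = ?w * of_rat (inverse a)" by (rule inverse_unique)
  then show ?thesis using \<open>?w \<in> cyc_field\<close> by (metis cyc_field_mult cyc_field_rat)
qed

section \<open>The generated field and the uniqueness of its automorphism\<close>

lemma Q_xi_0: "0 \<in> Q_xi"
  using Q_xi.diff [OF Q_xi.one Q_xi.one] by simp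

lemma Q_xi_minus: "x \<in> Q_xi \<Longrightarrow> - x \<in> Q_xi"
  using Q_xi.diff [OF Q_xi_0] by force

lemma Q_xi_add: "x \<in> Q_xi \<Longrightarrow> y \<in> Q_xi \<Longrightarrow> x + y \<in> Q_xi"
  using Q_xi.diff [of x "- y"] Q_xi_minus by simp

lemma Q_xi_divide: "x \<in> Q_xi \<Longrightarrow> y \<in> Q_xi \<Longrightarrow> x / y \<in> Q_xi"
  by (cases "y = 0") (simp_all add: Q_xi_0 divide_inverse Q_xi.mult Q_xi.inverse)

lemma Q_xi_power: "x \<in> Q_xi \<Longrightarrow> x ^ n \<in> Q_xi"
  by (induction n) (simp_all add: Q_xi.one Q_xi.mult)

lemma Q_xi_of_nat: "of_nat n \<in> Q_xi"
  by (induction n) (simp_all add: Q_xi_0 Q_xi_add Q_xi.one)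

lemma Q_xi_of_int: "of_int n \<in> Q_xi"
  by (cases n) (simp_all add: Q_xi_of_nat Q_xi_minus del: of_nat_Suc)

lemma Q_xi_of_rat: "of_rat a \<in> Q_xi"
  by (cases a) (simp add: of_rat_rat Q_xi_divide Q_xi_of_int)

lemma Q_xi_eq_cyc_field: "Q_xi = cyc_field"
proof
  show "cyc_field \<subseteq> Q_xi"
    by (auto simp: cyc_field_def cyc_def intro!: Q_xi_add Q_xi.mult Q_xi_of_rat Q_xi_power Q_xi.xi)
  have "xi = cyc 0 1 0 0 xi" "1 = cyc 1 0 0 0 xi" by (simp_all add: cyc_def)
  then have "xi \<in> cyc_field" "1 \<in> cyc_field" by (metis cyc_in_cyc_field)+
  then show "Q_xi \<subseteq> cyc_field"
    by (auto elim: Q_xi.induct intro: cyc_field_diff cyc_field_mult cyc_field_inverse)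
qed

lemma cnj_in_Q_xi: "x \<in> Q_xi \<Longrightarrow> cnj x \<in> Q_xi"
  unfolding Q_xi_eq_cyc_field using frob_in_cyc_field frob_frob by metis

lemma cnj_in_Q_xi_iff: "cnj x \<in> Q_xi \<longleftrightarrow> x \<in> Q_xi"
  using cnj_in_Q_xi by fastforce

lemma frob_xi: "frob xi = xi ^ 3"
  using frob_cyc [of 0 1 0 0] by (simp add: cyc_def)

text \<open>As the square of \<open>frob\<close> is conjugation, its inverse is its cube, that is,
  \<open>cnj\<close> after \<open>frob\<close>.\<close>

lemma field_automorphism_frob: "field_automorphism Q_xi (restrict frob Q_xi)"
  unfolding field_automorphism_def
proof (intro conjI ballI)
  have *: "frob (cnj x) = cnj (frob x)" if "x \<in> cyc_field" for x
    using that frob_frob frob_in_cyc_field by metis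
  show "bij_betw (restrict frob Q_xi) Q_xi Q_xi"
    unfolding Q_xi_eq_cyc_field
  proof (rule bij_betwI)
    show "restrict frob cyc_field \<in> cyc_field \<rightarrow> cyc_field" using frob_in_cyc_field by auto
    show "(\<lambda>x. cnj (frob x)) \<in> cyc_field \<rightarrow> cyc_field" using frob_in_cyc_field frob_frob by (metis Pi_I)
    show "cnj (frob (restrict frob cyc_field x)) = x" if "x \<in> cyc_field" for x
      using that frob_frob by simp
    show "restrict frob cyc_field (cnj (frob y)) = y" if "y \<in> cyc_field" for y
      using that frob_frob frob_in_cyc_field * by (metis complex_cnj_cnj restrict_apply')
  qed
qed (simp_all add: Q_xi_eq_cyc_field cyc_field_add cyc_field_mult frob_add frob_mult)

lemma field_automorphism_0:
  assumes "field_automorphism Q_xi h"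
  shows "h 0 = 0"
proof -
  have "h (0 + 0) = h 0 + h 0" using assms Q_xi_0 unfolding field_automorphism_def by blast
  then show ?thesis by simp
qed

lemma field_automorphism_1:
  assumes "field_automorphism Q_xi h"
  shows "h 1 = 1"
proof -
  have "h (1 * 1) = h 1 * h 1" using assms Q_xi.one unfolding field_automorphism_def by blast
  moreover have "h 1 \<noteq> h 0"
    using assms Q_xi.one Q_xi_0 unfolding field_automorphism_def
    by (metis bij_betw_imp_inj_on inj_onD zero_neq_one)
  ultimately show ?thesis using field_automorphism_0 [OF assms] by simp
qed

lemma field_automorphism_diff:
  assumes "field_automorphism Q_xi h" "x \<in> Q_xi" "y \<in> Q_xi"
  shows "h (x - y) = h x - h y"
proof -
  have "h (x - y + y) = h (x - y) + h y"
    using assms Q_xi.diff unfolding field_automorphism_def by blast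
  then show ?thesis by simp
qed

lemma field_automorphism_inverse:
  assumes "field_automorphism Q_xi h" "x \<in> Q_xi"
  shows "h (inverse x) = inverse (h x)"
proof (cases "x = 0")
  case False
  then have "h (inverse x * x) = h (inverse x) * h x"
    using assms Q_xi.inverse unfolding field_automorphism_def by blast
  with False field_automorphism_1 [OF assms(1)] show ?thesis
    by (simp add: inverse_unique [symmetric] mult.commute)
qed (simp add: field_automorphism_0 [OF assms(1)])

text \<open>The points where two automorphisms agree form a subfield, so agreement at the generator
  spreads along the inductive generation of \<open>Q_xi\<close>.\<close>

lemma field_automorphism_unique:
  assumes "field_automorphism Q_xi h" "field_automorphism Q_xi h'" "h xi = h' xi" "x \<in> Q_xi"
  shows "h x = h' x"
  using assms(4)
proof induction
  case (mult x y)
  then show ?case using assms(1,2) unfolding field_automorphism_def by metis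
qed (simp_all add: assms field_automorphism_1 field_automorphism_diff field_automorphism_inverse)

lemma star_aut_eq: "star_aut = restrict frob Q_xi"
  unfolding star_aut_def
proof (rule the_equality)
  show "field_automorphism Q_xi (restrict frob Q_xi) \<and> restrict frob Q_xi xi = xi ^ 3 \<and>
    restrict frob Q_xi \<in> extensional Q_xi"
    by (simp add: field_automorphism_frob frob_xi Q_xi.xi)
  fix h assume h: "field_automorphism Q_xi h \<and> h xi = xi ^ 3 \<and> h \<in> extensional Q_xi"
  show "h = restrict frob Q_xi"
  proof (rule extensionalityI)
    show "h x = restrict frob Q_xi x" if "x \<in> Q_xi" for x
      using field_automorphism_unique [OF _ field_automorphism_frob] h that
      by (simp add: frob_xi Q_xi.xi)
  qed (use h in auto)
qed

lemma field_automorphism_star_aut: "field_automorphism Q_xi star_aut"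
  by (simp add: star_aut_eq field_automorphism_frob)

lemma star_aut_in: "x \<in> Q_xi \<Longrightarrow> star_aut x \<in> Q_xi"
  by (simp add: star_aut_eq Q_xi_eq_cyc_field frob_in_cyc_field)

lemma star_aut_xi: "star_aut xi = xi ^ 3"
  by (simp add: star_aut_eq Q_xi.xi frob_xi)

lemmas star_aut_0 = field_automorphism_0 [OF field_automorphism_star_aut]
  and star_aut_1 = field_automorphism_1 [OF field_automorphism_star_aut]
  and star_aut_diff = field_automorphism_diff [OF field_automorphism_star_aut]

lemma star_aut_add: "x \<in> Q_xi \<Longrightarrow> y \<in> Q_xi \<Longrightarrow> star_aut (x + y) = star_aut x + star_aut y"
  and star_aut_mult: "x \<in> Q_xi \<Longrightarrow> y \<in> Q_xi \<Longrightarrow> star_aut (x * y) = star_aut x * star_aut y"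
  using field_automorphism_star_aut unfolding field_automorphism_def by blast+

lemma star_aut_minus: "x \<in> Q_xi \<Longrightarrow> star_aut (- x) = - star_aut x"
  using star_aut_diff [OF Q_xi_0] by (simp add: star_aut_0)

lemma star_aut_power: "x \<in> Q_xi \<Longrightarrow> star_aut (x ^ n) = star_aut x ^ n"
  by (induction n) (simp_all add: star_aut_1 star_aut_mult Q_xi_power)

lemma star_aut_star_aut: "x \<in> Q_xi \<Longrightarrow> star_aut (star_aut x) = cnj x"
  by (simp add: star_aut_eq Q_xi_eq_cyc_field frob_in_cyc_field frob_frob)

text \<open>Conjugation is the square of \<open>star_aut\<close>, and a map commutes with its own
  square.\<close>

lemma star_aut_cnj: "x \<in> Q_xi \<Longrightarrow> star_aut (cnj x) = cnj (star_aut x)"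
  using star_aut_star_aut star_aut_in by metis

lemma star_aut_eq_0_iff: "x \<in> Q_xi \<Longrightarrow> star_aut x = 0 \<longleftrightarrow> x = 0"
  using star_aut_star_aut star_aut_0 by (metis complex_cnj_zero_iff)

section \<open>Similarities of the plane and their duals\<close>

text \<open>Treats orientation preserving and reversing maps uniformly: for either value of
  \<open>c\<close> it is a field automorphism and an isometry, so most computations avoid a case
  distinction.\<close>

definition cnj_if :: "bool \<Rightarrow> complex \<Rightarrow> complex" where
  "cnj_if c x = (if c then cnj x else x)"

lemma sim_map_eq: "sim_map c \<alpha> \<beta> x = \<alpha> * cnj_if c x + \<beta>"
  by (simp add: sim_map_def cnj_if_def)

lemma cnj_if_simps [simp]:
  "cnj_if c (x + y) = cnj_if c x + cnj_if c y"
  "cnj_if c (x - y) = cnj_if c x - cnj_if c y"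
  "cnj_if c (x * y) = cnj_if c x * cnj_if c y"
  "cnj_if c (x / y) = cnj_if c x / cnj_if c y"
  "cnj_if c (- x) = - cnj_if c x"
  "cnj_if c (of_real r) = of_real r"
  "cnj_if c 0 = 0" "cnj_if c 1 = 1"
  "cnj_if c x = 0 \<longleftrightarrow> x = 0"
  "cnj_if c (cnj_if c' x) = cnj_if (c \<noteq> c') x"
  "cmod (cnj_if c x) = cmod x"
  by (simp_all add: cnj_if_def)

lemma cnj_if_in_Q_xi [simp]: "cnj_if c x \<in> Q_xi \<longleftrightarrow> x \<in> Q_xi"
  by (simp add: cnj_if_def cnj_in_Q_xi_iff)

lemma star_aut_cnj_if: "x \<in> Q_xi \<Longrightarrow> star_aut (cnj_if c x) = cnj_if c (star_aut x)"
  by (simp add: cnj_if_def star_aut_cnj)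

lemma sim_map_comp:
  "sim_map c \<alpha> \<beta> \<circ> sim_map c' \<alpha>' \<beta>' =
    sim_map (c \<noteq> c') (\<alpha> * cnj_if c \<alpha>') (\<alpha> * cnj_if c \<beta>' + \<beta>)"
  by (auto simp: fun_eq_iff sim_map_def cnj_if_def algebra_simps)

lemma sim_map_inverses:
  assumes "\<alpha> \<noteq> 0"
  shows "sim_map c \<alpha> \<beta> \<circ> sim_map c (cnj_if c (1 / \<alpha>)) (cnj_if c (- \<beta> / \<alpha>)) = id"
    and "sim_map c (cnj_if c (1 / \<alpha>)) (cnj_if c (- \<beta> / \<alpha>)) \<circ> sim_map c \<alpha> \<beta> = id"
  using assms by (simp_all add: fun_eq_iff sim_map_def cnj_if_def field_simps)

lemma bij_sim_map: "\<alpha> \<noteq> 0 \<Longrightarrow> bij (sim_map c \<alpha> \<beta>)"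
  using sim_map_inverses by (metis o_bij)

lemma inv_sim_map:
  "\<alpha> \<noteq> 0 \<Longrightarrow> inv (sim_map c \<alpha> \<beta>) = sim_map c (cnj_if c (1 / \<alpha>)) (cnj_if c (- \<beta> / \<alpha>))"
  using sim_map_inverses by (metis inv_unique_comp)

lemma sim_map_eq_iff:
  assumes "\<alpha> \<noteq> 0"
  shows "sim_map c \<alpha> \<beta> = sim_map c' \<alpha>' \<beta>' \<longleftrightarrow> c = c' \<and> \<alpha> = \<alpha>' \<and> \<beta> = \<beta>'"
proof
  assume eq: "sim_map c \<alpha> \<beta> = sim_map c' \<alpha>' \<beta>'"
  have "\<beta> = \<beta>'" using fun_cong [OF eq, of 0] by (simp add: sim_map_eq)
  moreover from this have "\<alpha> = \<alpha>'" using fun_cong [OF eq, of 1] by (simp add: sim_map_eq)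
  moreover from calculation have "c = c'" using fun_cong [OF eq, of \<i>] assms
    by (auto simp: sim_map_def split: if_splits)
  ultimately show "c = c' \<and> \<alpha> = \<alpha>' \<and> \<beta> = \<beta>'" by simp
qed simp

lemma sim_map_diff: "sim_map c \<alpha> \<beta> x - sim_map c \<alpha> \<beta> y = \<alpha> * cnj_if c (x - y)"
  by (simp add: sim_map_eq algebra_simps)

lemma similarity_sim_map: "similarity (cmod \<alpha>) (sim_map c \<alpha> \<beta>)"
  by (simp add: similarity_def dist_norm sim_map_diff norm_mult del: cnj_if_simps(2))

lemma similarity_sim_map_iff: "similarity s (sim_map c \<alpha> \<beta>) \<longleftrightarrow> s = cmod \<alpha>"
proof
  assume "similarity s (sim_map c \<alpha> \<beta>)"
  then have "dist (sim_map c \<alpha> \<beta> 1) (sim_map c \<alpha> \<beta> 0) = s * dist (1::complex) 0"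
    unfolding similarity_def by blast
  then show "s = cmod \<alpha>" by (simp add: dist_norm sim_map_diff)
qed (simp add: similarity_sim_map)

text \<open>Distances to 0 and 1 determine the real part and the imaginary part up to sign. The sign
  could still vary from point to point; the distance to the image of \<open>\<i>\<close> rules this
  out.\<close>

lemma isometry_fixing_0_1:
  fixes h :: "complex \<Rightarrow> complex"
  assumes iso: "\<And>x y. dist (h x) (h y) = dist x y" and "h 0 = 0" "h 1 = 1"
  shows "\<exists>c. h = cnj_if c"
proof -
  have n: "(Re (h x))\<^sup>2 + (Im (h x))\<^sup>2 = (Re x)\<^sup>2 + (Im x)\<^sup>2" for x
    using iso [of x 0] assms(2) by (simp add: dist_norm cmod_def)
  have n1: "(Re (h x) - 1)\<^sup>2 + (Im (h x))\<^sup>2 = (Re x - 1)\<^sup>2 + (Im x)\<^sup>2" for x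
    using iso [of x 1] assms(3) by (simp add: dist_norm cmod_def)
  have re: "Re (h x) = Re x" for x
    using n [of x] n1 [of x] by (simp add: power2_eq_square algebra_simps)
  have im: "(Im (h x))\<^sup>2 = (Im x)\<^sup>2" for x
    using n [of x] re by simp
  \<comment> \<open>Expanding the square of the distance leaves only the mixed term, which ties the
    sign at \<open>x\<close> to the sign at \<open>\<i>\<close>.\<close>
  have prod: "Im (h x) * Im (h \<i>) = Im x" for x
  proof -
    have "(Im (h x) - Im (h \<i>))\<^sup>2 = (Im x - 1)\<^sup>2"
      using iso [of x \<i>] re by (simp add: dist_norm cmod_def)
    moreover have "(Im (h \<i>))\<^sup>2 = 1" using im [of \<i>] by simp
    ultimately show ?thesis using im [of x] unfolding power2_diff by simp
  qed
  have "Im (h \<i>) = 1 \<or> Im (h \<i>) = -1"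
    using im [of \<i>] by (simp add: power2_eq_1_iff)
  then show ?thesis
  proof
    assume "Im (h \<i>) = 1"
    with prod re have "h = cnj_if False" by (simp add: fun_eq_iff cnj_if_def complex_eq_iff)
    then show ?thesis ..
  next
    assume "Im (h \<i>) = -1"
    then have "Im (h x) = - Im x" for x using prod [of x] by simp
    with re have "h = cnj_if True" by (simp add: fun_eq_iff cnj_if_def complex_eq_iff)
    then show ?thesis ..
  qed
qed

lemma similarity_cases:
  assumes "similarity s f" "s > 0"
  obtains c \<alpha> \<beta> where "cmod \<alpha> = s" "\<alpha> \<noteq> 0" "f = sim_map c \<alpha> \<beta>"
proof -
  define \<alpha> where "\<alpha> = f 1 - f 0"
  have d: "cmod (f x - f y) = s * cmod (x - y)" for x y
    using assms(1) by (simp add: similarity_def dist_norm)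
  from d [of 1 0] have \<alpha>: "cmod \<alpha> = s" by (simp add: \<alpha>_def)
  with assms(2) have "\<alpha> \<noteq> 0" by auto
  define h where "h x = (f x - f 0) / \<alpha>" for x
  have "h x - h y = (f x - f y) / \<alpha>" for x y by (simp add: h_def diff_divide_distrib)
  then have "dist (h x) (h y) = dist x y" for x y
    using d \<alpha> \<open>s > 0\<close> by (simp add: dist_norm norm_divide)
  moreover have "h 0 = 0" "h 1 = 1" using \<open>\<alpha> \<noteq> 0\<close> by (simp_all add: h_def \<alpha>_def)
  ultimately obtain c where c: "h = cnj_if c" using isometry_fixing_0_1 by blast
  have "f x = \<alpha> * h x + f 0" for x using \<open>\<alpha> \<noteq> 0\<close> by (simp add: h_def)
  then have "f = sim_map c \<alpha> (f 0)" unfolding fun_eq_iff sim_map_eq c by blast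
  with \<alpha> \<open>\<alpha> \<noteq> 0\<close> that show thesis by blast
qed

lemma similarity_bij: "similarity s f \<Longrightarrow> s > 0 \<Longrightarrow> bij f"
  by (elim similarity_cases) (auto intro: bij_sim_map)

lemma similarity_comp: "similarity s f \<Longrightarrow> similarity t g \<Longrightarrow> similarity (s * t) (f \<circ> g)"
  by (simp add: similarity_def)

lemma similarity_inv:
  assumes "similarity s f" "s > 0"
  shows "similarity (1 / s) (inv f)"
proof -
  have "f (inv f x) = x" for x
    using similarity_bij [OF assms] by (simp add: bij_is_surj surj_f_inv_f)
  then have eq: "dist x y = s * dist (inv f x) (inv f y)" for x y
    using assms(1) unfolding similarity_def by metis
  show ?thesis
    unfolding similarity_def
  proof (intro allI)
    fix x y
    show "dist (inv f x) (inv f y) = 1 / s * dist x y"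
      using eq [of x y] assms(2) by simp
  qed
qed

text \<open>The action of a pair of moves, one per prototile, on function systems.
  \<open>same_substitution\<close> is the orbit relation of this action restricted to similarities
  with a common ratio, which makes it an equivalence.\<close>

definition transport :: "(tile \<Rightarrow> complex \<Rightarrow> complex) \<Rightarrow> function_system \<Rightarrow> function_system" where
  "transport g F i j = (\<lambda>f. g j \<circ> f \<circ> inv (g i)) ` F i j"

lemma same_substitution_iff:
  "same_substitution F G \<longleftrightarrow> (\<exists>s>0. \<exists>g. (\<forall>i. similarity s (g i)) \<and> G = transport g F)"
  by (simp add: same_substitution_def transport_def fun_eq_iff)

lemma same_substitutionI:
  "s > 0 \<Longrightarrow> (\<And>i. similarity s (g i)) \<Longrightarrow> G = transport g F \<Longrightarrow> same_substitution F G"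
  unfolding same_substitution_iff by blast

lemma transport_transport:
  assumes "\<And>i. bij (g i)" "\<And>i. bij (h i)"
  shows "transport g (transport h F) = transport (\<lambda>i. g i \<circ> h i) F"
  by (simp add: fun_eq_iff transport_def image_image o_inv_distrib assms o_assoc)

lemma transport_id: "transport (\<lambda>i. id) F = F"
  by (simp add: transport_def fun_eq_iff)

lemma same_substitution_refl: "same_substitution F F"
proof -
  have "similarity 1 id" by (simp add: similarity_def)
  then show ?thesis unfolding same_substitution_iff by (metis transport_id zero_less_one)
qed

lemma same_substitution_trans:
  assumes "same_substitution F G" "same_substitution G H"
  shows "same_substitution F H"
proof -
  obtain s g where g: "s > 0" "\<And>i. similarity s (g i)" "G = transport g F"
    using assms(1) unfolding same_substitution_iff by blast
  obtain t h where h: "t > 0" "\<And>i. similarity t (h i)" "H = transport h G"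
    using assms(2) unfolding same_substitution_iff by blast
  show ?thesis
  proof (rule same_substitutionI)
    show "t * s > 0" using g(1) h(1) by simp
    show "similarity (t * s) (h i \<circ> g i)" for i
      using h(2) g(2) by (rule similarity_comp)
    show "H = transport (\<lambda>i. h i \<circ> g i) F"
      unfolding g(3) h(3) using similarity_bij [OF h(2,1)] similarity_bij [OF g(2,1)]
      by (rule transport_transport)
  qed
qed

lemma same_substitution_sym:
  assumes "same_substitution F G"
  shows "same_substitution G F"
proof -
  obtain s g where g: "s > 0" "\<And>i. similarity s (g i)" "G = transport g F"
    using assms unfolding same_substitution_iff by blast
  have b: "bij (g i)" for i using g(2,1) by (rule similarity_bij)
  show ?thesis
  proof (rule same_substitutionI)
    show "1 / s > 0" using g(1) by simp
    show "similarity (1 / s) (inv (g i))" for i using g(2,1) by (rule similarity_inv)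
    have "inv (g i) \<circ> g i = id" for i using b by (simp add: bij_is_inj)
    then show "F = transport (\<lambda>i. inv (g i)) G"
      unfolding g(3) using b by (simp add: transport_transport bij_imp_bij_inv transport_id)
  qed
qed

section \<open>The group of maps over the field and the automorphism induced on it\<close>

definition Q_xi_maps :: "(complex \<Rightarrow> complex) set" where
  "Q_xi_maps = {f. \<exists>c. \<exists>\<alpha>\<in>Q_xi. \<exists>\<beta>\<in>Q_xi. \<alpha> \<noteq> 0 \<and> f = sim_map c \<alpha> \<beta>}"

lemma over_Q_xi_iff: "over_Q_xi F \<longleftrightarrow> (\<forall>i j. F i j \<subseteq> Q_xi_maps)"
  by (auto simp: over_Q_xi_def Q_xi_maps_def subset_iff)

lemma Q_xi_mapsI: "\<alpha> \<in> Q_xi \<Longrightarrow> \<beta> \<in> Q_xi \<Longrightarrow> \<alpha> \<noteq> 0 \<Longrightarrow> sim_map c \<alpha> \<beta> \<in> Q_xi_maps"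
  by (auto simp: Q_xi_maps_def)

lemma Q_xi_mapsE:
  assumes "f \<in> Q_xi_maps"
  obtains c \<alpha> \<beta> where "\<alpha> \<in> Q_xi" "\<beta> \<in> Q_xi" "\<alpha> \<noteq> 0" "f = sim_map c \<alpha> \<beta>"
  using assms by (auto simp: Q_xi_maps_def)

lemma Q_xi_maps_bij: "f \<in> Q_xi_maps \<Longrightarrow> bij f"
  by (elim Q_xi_mapsE) (simp add: bij_sim_map)

lemma Q_xi_maps_comp: "f \<in> Q_xi_maps \<Longrightarrow> g \<in> Q_xi_maps \<Longrightarrow> f \<circ> g \<in> Q_xi_maps"
  by (elim Q_xi_mapsE)
    (simp add: sim_map_comp, intro Q_xi_mapsI Q_xi_add Q_xi.mult, simp_all)

lemma Q_xi_maps_inv: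
  assumes "f \<in> Q_xi_maps"
  shows "inv f \<in> Q_xi_maps"
proof -
  obtain c \<alpha> \<beta> where f: "\<alpha> \<in> Q_xi" "\<beta> \<in> Q_xi" "\<alpha> \<noteq> 0" "f = sim_map c \<alpha> \<beta>"
    using assms by (elim Q_xi_mapsE)
  have "1 / \<alpha> \<in> Q_xi" "- \<beta> / \<alpha> \<in> Q_xi"
    by (intro Q_xi_divide Q_xi_minus Q_xi.one f)+
  moreover have "1 / \<alpha> \<noteq> 0" using f(3) by simp
  ultimately show ?thesis
    unfolding f(4) inv_sim_map [OF f(3)]
    by (intro Q_xi_mapsI) (simp_all only: cnj_if_in_Q_xi cnj_if_simps(9) not_False_eq_True)
qed

text \<open>The half of \<open>sharp\<close> without the inversion. It respects composition, whereas
  \<open>sharp\<close> reverses it, so identities are proved for \<open>star_map\<close> and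
  transferred.\<close>

definition star_map :: "(complex \<Rightarrow> complex) \<Rightarrow> complex \<Rightarrow> complex" where
  "star_map f = (THE g. \<exists>c \<alpha> \<beta>. \<alpha> \<noteq> 0 \<and> f = sim_map c \<alpha> \<beta> \<and>
     g = sim_map c (star_aut \<alpha>) (star_aut \<beta>))"

lemma sharp_eq: "sharp f = star_map (inv f)"
  by (simp add: sharp_def star_map_def)

lemma star_map_sim_map:
  assumes "\<alpha> \<noteq> 0"
  shows "star_map (sim_map c \<alpha> \<beta>) = sim_map c (star_aut \<alpha>) (star_aut \<beta>)"
  unfolding star_map_def
  by (rule the_equality) (use assms in \<open>auto simp: sim_map_eq_iff\<close>)

lemma star_map_in: "f \<in> Q_xi_maps \<Longrightarrow> star_map f \<in> Q_xi_maps"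
  by (elim Q_xi_mapsE)
    (simp add: star_map_sim_map Q_xi_mapsI star_aut_in star_aut_eq_0_iff)

lemma star_map_comp:
  assumes "f \<in> Q_xi_maps" "g \<in> Q_xi_maps"
  shows "star_map (f \<circ> g) = star_map f \<circ> star_map g"
  using assms
  by (elim Q_xi_mapsE) (simp add: sim_map_comp star_map_sim_map star_aut_add star_aut_mult
      Q_xi.mult star_aut_cnj_if)

lemma star_map_id: "star_map id = id"
proof -
  have "id = sim_map False 1 0" by (simp add: fun_eq_iff sim_map_def)
  then show ?thesis by (metis star_map_sim_map star_aut_0 star_aut_1 zero_neq_one)
qed

lemma star_map_inv:
  assumes "f \<in> Q_xi_maps"
  shows "star_map (inv f) = inv (star_map f)"
proof -
  have "bij f" using assms by (rule Q_xi_maps_bij)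
  then have "f \<circ> inv f = id" "inv f \<circ> f = id"
    by (simp_all add: bij_is_surj bij_is_inj flip: surj_iff)
  then have "star_map f \<circ> star_map (inv f) = id" "star_map (inv f) \<circ> star_map f = id"
    using assms star_map_comp star_map_id Q_xi_maps_inv by metis+
  then show ?thesis by (metis inv_unique_comp)
qed

text \<open>The reversal of composition by \<open>sharp\<close> is compensated by the exchange of
  the tile indices: a conjugated map goes again to a conjugated map, with
  \<open>star_map (g j)\<close> on the target side of the dual.\<close>

lemma dual_system_transport:
  assumes F: "over_Q_xi F" and g: "\<And>i. g i \<in> Q_xi_maps"
  shows "dual_system (transport g F) = transport (\<lambda>i. star_map (g i)) (dual_system F)"
proof -
  have *: "sharp (g i \<circ> f \<circ> inv (g j)) = star_map (g j) \<circ> sharp f \<circ> inv (star_map (g i))"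
    if "f \<in> F j i" for f i j
  proof -
    have f: "f \<in> Q_xi_maps" using F that by (auto simp: over_Q_xi_iff)
    have b: "bij f" "bij (g i)" "bij (g j)" using f g by (simp_all add: Q_xi_maps_bij)
    have "inv (g i \<circ> f \<circ> inv (g j)) = g j \<circ> inv f \<circ> inv (g i)"
      using b by (simp add: o_inv_distrib bij_comp bij_imp_bij_inv inv_inv_eq o_assoc)
    then show ?thesis using f g
      by (simp add: sharp_eq star_map_comp star_map_inv Q_xi_maps_comp Q_xi_maps_inv)
  qed
  show ?thesis
    unfolding dual_system_def transport_def image_image
    by (intro ext image_cong refl *)
qed

section \<open>Moves between representatives over the field\<close>

text \<open>Moduli themselves change, but the squared modulus is \<open>z * cnj z\<close>, an
  element of the field, and commuting with conjugation shows that the squared modulus of the image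
  is the image of the squared modulus. This keeps the scaling of the two prototiles common after
  dualizing.\<close>

lemma cmod_star_aut_eq:
  assumes "x \<in> Q_xi" "y \<in> Q_xi" "cmod x = cmod y"
  shows "cmod (star_aut x) = cmod (star_aut y)"
proof -
  have *: "of_real ((cmod (star_aut z))\<^sup>2) = star_aut (of_real ((cmod z)\<^sup>2))" if "z \<in> Q_xi" for z
    using that by (simp add: complex_norm_square star_aut_mult star_aut_cnj cnj_in_Q_xi
        del: of_real_power)
  have "complex_of_real ((cmod (star_aut x))\<^sup>2) = of_real ((cmod (star_aut y))\<^sup>2)"
    unfolding * [OF assms(1)] * [OF assms(2)] assms(3) ..
  then have "(cmod (star_aut x))\<^sup>2 = (cmod (star_aut y))\<^sup>2" by (simp only: of_real_eq_iff)
  then show ?thesis by simp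
qed

lemma similarity_star_map:
  assumes "\<And>i. g i \<in> Q_xi_maps" "\<And>i :: tile. similarity s (g i)"
  shows "\<exists>t>0. \<forall>i. similarity t (star_map (g i))"
proof -
  have "\<forall>i. \<exists>c \<alpha> \<beta>. \<alpha> \<in> Q_xi \<and> \<alpha> \<noteq> 0 \<and> g i = sim_map c \<alpha> \<beta>"
    using assms(1) Q_xi_mapsE by metis
  then obtain c \<alpha> \<beta> where g: "\<alpha> i \<in> Q_xi" "\<alpha> i \<noteq> 0" "g i = sim_map (c i) (\<alpha> i) (\<beta> i)" for i
    by metis
  have "cmod (\<alpha> i) = cmod (\<alpha> Small)" for i
    using assms(2) [of i] assms(2) [of Small] by (simp add: g(3) similarity_sim_map_iff)
  then have "cmod (star_aut (\<alpha> i)) = cmod (star_aut (\<alpha> Small))" for i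
    using cmod_star_aut_eq g(1) by blast
  then have "similarity (cmod (star_aut (\<alpha> Small))) (star_map (g i))" for i
    unfolding g(3) star_map_sim_map [OF g(2)] similarity_sim_map_iff by (rule sym)
  moreover have "cmod (star_aut (\<alpha> Small)) > 0" using g by (simp add: star_aut_eq_0_iff)
  ultimately show ?thesis by blast
qed

text \<open>The equation \<open>f x = x\<close> may involve \<open>cnj x\<close>; the one for the
  second iterate is linear in \<open>x\<close> alone, and its leading coefficient has modulus below
  1, so it is solved by a division in the field.\<close>

lemma fixed_point_in_Q_xi:
  assumes f: "f \<in> Q_xi_maps" and sim: "similarity s f" "s < 1" and x: "f x = x"
  shows "x \<in> Q_xi"
proof -
  obtain c \<alpha> \<beta> where g: "\<alpha> \<in> Q_xi" "\<beta> \<in> Q_xi" "\<alpha> \<noteq> 0" "f = sim_map c \<alpha> \<beta>"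
    using f by (elim Q_xi_mapsE)
  have "cmod \<alpha> < 1" using sim g by (simp add: similarity_sim_map_iff)
  \<comment> \<open>The iterate \<open>f \<circ> f\<close> is orientation preserving.\<close>
  define \<gamma> where "\<gamma> = \<alpha> * cnj_if c \<alpha>"
  define \<delta> where "\<delta> = \<alpha> * cnj_if c \<beta> + \<beta>"
  have in_Q: "\<gamma> \<in> Q_xi" "\<delta> \<in> Q_xi"
    unfolding \<gamma>_def \<delta>_def using g by (simp_all add: Q_xi.mult Q_xi_add)
  have "cmod \<gamma> < 1 * 1" unfolding \<gamma>_def norm_mult cnj_if_simps
    using \<open>cmod \<alpha> < 1\<close> by (intro mult_strict_mono) auto
  then have "\<gamma> \<noteq> 1" by auto
  have "(f \<circ> f) x = x" using x by simp
  then have "\<gamma> * x + \<delta> = x"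
    by (simp only: g(4) sim_map_comp \<gamma>_def [symmetric] \<delta>_def [symmetric])
      (simp add: sim_map_def)
  then have "x = \<delta> / (1 - \<gamma>)" using \<open>\<gamma> \<noteq> 1\<close> by (simp add: field_simps)
  with in_Q show ?thesis by (simp add: Q_xi_divide Q_xi.diff Q_xi.one)
qed

lemma fixed_point_exists:
  assumes "similarity s f" "0 \<le> s" "s < 1"
  shows "\<exists>x. f x = x"
proof -
  have "\<exists>!x\<in>UNIV. f x = x"
    by (rule Banach_fix [of _ s]) (use assms in \<open>auto simp: similarity_def complete_UNIV\<close>)
  then show ?thesis by blast
qed

text \<open>The fixed points \<open>x\<close> and \<open>y\<close> are distinct points of the field
  whose images under \<open>g\<close> are fixed points of maps over the field. Two points with their
  images determine both coefficients of a similarity by field operations, whichever its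
  orientation.\<close>

lemma conjugator_in_Q_xi_maps:
  assumes g: "similarity t g" "t > 0" and s: "0 < s" "s < 1"
    and f: "f \<in> Q_xi_maps" "similarity s f" "f x = x" "g \<circ> f \<circ> inv g \<in> Q_xi_maps"
    and f': "f' \<in> Q_xi_maps" "similarity s f'" "f' x \<noteq> x" "g \<circ> f' \<circ> inv g \<in> Q_xi_maps"
  shows "g \<in> Q_xi_maps"
proof -
  have inj: "inv g (g y) = y" for y using g by (simp add: similarity_bij bij_is_inj)
  have sim: "similarity s (g \<circ> h \<circ> inv g)" if "similarity s h" for h
    using similarity_comp [OF similarity_comp [OF g(1) that] similarity_inv [OF g]] g(2) by simp
  obtain y where y: "f' y = y" using fixed_point_exists f' s by force
  have xy: "x \<in> Q_xi" "y \<in> Q_xi" "x \<noteq> y"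
    using fixed_point_in_Q_xi f f' s y by auto
  have gxy: "g x \<in> Q_xi" "g y \<in> Q_xi"
    using fixed_point_in_Q_xi [OF f(4) sim [OF f(2)] s(2), of "g x"]
      fixed_point_in_Q_xi [OF f'(4) sim [OF f'(2)] s(2), of "g y"] f y
    by (simp_all add: inj)
  obtain c \<alpha> \<beta> where \<alpha>: "\<alpha> \<noteq> 0" "g = sim_map c \<alpha> \<beta>" using g by (elim similarity_cases)
  have "\<alpha> = (g x - g y) / cnj_if c (x - y)"
    using xy unfolding \<alpha>(2) sim_map_diff by (simp add: cnj_if_def)
  then have "\<alpha> \<in> Q_xi" using xy gxy by (simp add: Q_xi_divide Q_xi.diff del: cnj_if_simps(2))
  moreover have "\<beta> = g x - \<alpha> * cnj_if c x" by (simp add: \<alpha> sim_map_eq)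
  then have "\<beta> \<in> Q_xi" using \<open>\<alpha> \<in> Q_xi\<close> xy gxy by (simp add: Q_xi.mult Q_xi.diff)
  ultimately show ?thesis using \<alpha> Q_xi_mapsI by simp
qed

text \<open>The two self-maps of \<open>Large\<close> have different fixed points, which pins down its conjugating
  map; the map from \<open>Small\<close> to \<open>Large\<close> then pins down that of \<open>Small\<close>.\<close>

definition rigid :: "function_system \<Rightarrow> bool" where
  "rigid P \<longleftrightarrow> over_Q_xi P \<and> (\<forall>f\<in>P Large Large. similarity (1 / tau) f) \<and>
     (\<exists>f\<in>P Large Large. \<exists>f'\<in>P Large Large. \<exists>x. f x = x \<and> f' x \<noteq> x) \<and> P Small Large \<noteq> {}"

lemma transporter_in_Q_xi_maps:
  assumes P: "rigid P" and s: "s > 0" and g: "\<And>i. similarity s (g i)"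
    and F: "over_Q_xi (transport g P)"
  shows "g i \<in> Q_xi_maps"
proof -
  have F: "g j \<circ> f \<circ> inv (g i) \<in> Q_xi_maps" if "f \<in> P i j" for f i j
    using F that by (auto simp: over_Q_xi_iff transport_def)
  have P': "f \<in> Q_xi_maps" if "f \<in> P i j" for f i j
    using P that by (auto simp: rigid_def over_Q_xi_iff)
  obtain f f' h x where f: "f \<in> P Large Large" "f' \<in> P Large Large" "f x = x" "f' x \<noteq> x"
    and h: "h \<in> P Small Large" and sim: "similarity (1 / tau) f" "similarity (1 / tau) f'"
    using P unfolding rigid_def by blast
  have L: "g Large \<in> Q_xi_maps"
    using conjugator_in_Q_xi_maps [where t = s and s = "1 / tau" and g = "g Large" and f = f
        and f' = f' and x = x] g s f sim F P' tau_gt_1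
    by (simp add: tau_pos)
  let ?k = "g Large \<circ> h \<circ> inv (g Small)"
  \<comment> \<open>Solving the definition of \<open>?k\<close> for the unknown move expresses
    \<open>g Small\<close> through maps already known to lie in the group.\<close>
  have "inv ?k \<circ> g Large \<circ> h = g Small"
  proof -
    have b: "bij (g Large)" "bij (g Small)" "bij h"
      using similarity_bij [OF g s] P' [OF h] by (simp_all add: Q_xi_maps_bij)
    then have "inv ?k = g Small \<circ> inv h \<circ> inv (g Large)"
      by (simp add: o_inv_distrib bij_comp bij_imp_bij_inv inv_inv_eq o_assoc)
    with b show ?thesis by (simp add: fun_eq_iff bij_is_inj)
  qed
  moreover have "inv ?k \<circ> g Large \<circ> h \<in> Q_xi_maps"
    by (intro Q_xi_maps_comp Q_xi_maps_inv L P' [OF h] F [OF h])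
  ultimately have "g Small \<in> Q_xi_maps" by simp
  with L show ?thesis by (cases i) auto
qed

lemma same_substitution_dual:
  assumes "rigid P" "same_substitution P F" "over_Q_xi F"
  shows "same_substitution (dual_system P) (dual_system F)"
proof -
  obtain s g where g: "s > 0" "\<And>i. similarity s (g i)" "F = transport g P"
    using assms(2) unfolding same_substitution_iff by blast
  have over: "over_Q_xi (transport g P)" using assms(3) by (simp only: g(3))
  have in_Q: "g i \<in> Q_xi_maps" for i
    using assms(1) g(1,2) over by (rule transporter_in_Q_xi_maps)
  have "over_Q_xi P" using assms(1) by (simp add: rigid_def)
  then have eq: "dual_system F = transport (\<lambda>i. star_map (g i)) (dual_system P)"
    unfolding g(3) using in_Q by (rule dual_system_transport)
  obtain t where "t > 0" "\<forall>i. similarity t (star_map (g i))"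
    using similarity_star_map [where g = g, OF in_Q g(2)] by blast
  then show ?thesis by (intro same_substitutionI [OF _ _ eq]) auto
qed

section \<open>Uniqueness of solutions and dissections of triangles\<close>

lemma sim_map_hull:
  "sim_map c \<alpha> \<beta> ` (convex hull S) = convex hull (sim_map c \<alpha> \<beta> ` S)"
proof -
  have lin: "linear (\<lambda>x. \<alpha> * cnj_if c x)"
    by (rule linearI) (simp_all add: cnj_if_def algebra_simps scaleR_conv_of_real)
  have "sim_map c \<alpha> \<beta> ` T = (+) \<beta> ` (\<lambda>x. \<alpha> * cnj_if c x) ` T" for T
    by (simp add: image_image sim_map_eq add.commute)
  then show ?thesis
    by (simp only: convex_hull_translation convex_hull_linear_image [OF lin])
qed

lemma interior_sim_map:
  assumes "\<alpha> \<noteq> 0"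
  shows "interior (sim_map c \<alpha> \<beta> ` S) = sim_map c \<alpha> \<beta> ` interior S"
proof -
  have lin: "linear (\<lambda>x. \<alpha> * cnj_if c x)"
    by (rule linearI) (simp_all add: cnj_if_def algebra_simps scaleR_conv_of_real)
  have inj: "inj (\<lambda>x. \<alpha> * cnj_if c x)"
    using assms by (auto simp: inj_def cnj_if_def)
  have "sim_map c \<alpha> \<beta> ` T = (+) \<beta> ` (\<lambda>x. \<alpha> * cnj_if c x) ` T" for T
    by (simp add: image_image sim_map_eq add.commute)
  then show ?thesis
    by (simp only: interior_translation interior_injective_linear_image [OF lin inj])
qed

lemma similarity_hull:
  "similarity s g \<Longrightarrow> s > 0 \<Longrightarrow> g ` (convex hull S) = convex hull (g ` S)"
  by (metis similarity_cases sim_map_hull)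

lemma similarity_interior:
  "similarity s g \<Longrightarrow> s > 0 \<Longrightarrow> interior (g ` S) = g ` interior S"
  by (metis similarity_cases interior_sim_map)

lemma similarity_affine:
  "similarity s g \<Longrightarrow> s > 0 \<Longrightarrow> g (x + of_real t * (y - x)) = g x + of_real t * (g y - g x)"
  by (erule (1) similarity_cases) (clarsimp simp: sim_map_eq algebra_simps)

lemma similarity_compact:
  assumes "similarity s g" "compact S"
  shows "compact (g ` S)"
proof (rule compact_continuous_image [OF _ assms(2)])
  have "s * dist x y \<le> \<bar>s\<bar> * dist x y" for x y :: complex
    by (intro mult_right_mono) auto
  then have "\<bar>s\<bar>-lipschitz_on S g"
    using assms(1) by (auto intro!: lipschitz_onI simp: similarity_def)
  then show "continuous_on S g" by (rule lipschitz_on_continuous_on)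
qed

section \<open>Uniqueness of the prototiles\<close>

lemma solution_union: "solution F X \<Longrightarrow> X j = (\<Union>i. \<Union>f\<in>F i j. f ` X i)"
  unfolding solution_def by (elim allE conjE)

text \<open>A contraction argument carried out at extremal points: \<open>m k\<close> is the largest
  distance from a point of some \<open>X j\<close> to \<open>Y j\<close>. The point attaining it
  lies in a piece, hence is the image of a point of some \<open>X i\<close>, and mapping a nearest
  point of \<open>Y i\<close> along gives \<open>m k \<le> s * m k\<close>. So the distance
  vanishes, and closedness gives the inclusion.\<close>

lemma solution_unique_subset:
  assumes sim: "\<And>i j f. f \<in> F i j \<Longrightarrow> similarity s f" and s: "0 \<le> s" "s < 1"
    and X: "solution F X" and Y: "solution F Y"
  shows "X j \<subseteq> Y j"
proof -
  have comp: "compact (X j)" "X j \<noteq> {}" "compact (Y j)" "Y j \<noteq> {}" for j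
    using X Y unfolding solution_def by blast+
  have "\<exists>x\<in>X j. \<forall>y\<in>X j. infdist y (Y j) \<le> infdist x (Y j)" for j
    using comp by (intro continuous_attains_sup continuous_intros)
  then obtain x where x: "x j \<in> X j" "\<And>y. y \<in> X j \<Longrightarrow> infdist y (Y j) \<le> infdist (x j) (Y j)" for j
    by metis
  define m where "m j = infdist (x j) (Y j)" for j
  define k where "k = (if m Small \<le> m Large then Large else Small)"
  have m: "m j \<le> m k" for j by (cases j) (simp_all add: k_def)
  have "x k \<in> (\<Union>i. \<Union>f\<in>F i k. f ` X i)" using x(1) [of k] unfolding solution_union [OF X, of k] .
  then obtain i f x' where f: "f \<in> F i k" "x' \<in> X i" "x k = f x'" by auto
  obtain y' where y': "y' \<in> Y i" "infdist x' (Y i) = dist x' y'"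
    using infdist_attains_inf [OF compact_imp_closed [OF comp(3)] comp(4)] by blast
  have "f y' \<in> (\<Union>i. \<Union>f\<in>F i k. f ` Y i)" using f y' by blast
  then have "f y' \<in> Y k" unfolding solution_union [OF Y, of k] .
  then have "m k \<le> dist (f x') (f y')" unfolding m_def f(3) by (rule infdist_le)
  also have "\<dots> = s * dist x' y'" using sim [OF f(1)] by (simp add: similarity_def)
  also have "\<dots> \<le> s * m k"
    using x(2) [OF f(2)] m [of i] s y'(2) unfolding m_def by (intro mult_left_mono) auto
  finally have "(1 - s) * m k \<le> 0" by (simp add: algebra_simps)
  with s have "m k \<le> 0" by (simp add: mult_le_0_iff)
  then have "infdist y (Y j) = 0" if "y \<in> X j" for y
    using x(2) [OF that] m [of j] infdist_nonneg [of y "Y j"] unfolding m_def by linarith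
  then show ?thesis
    using comp in_closed_iff_infdist_zero compact_imp_closed by blast
qed

lemma solution_unique:
  assumes "\<And>i j f. f \<in> F i j \<Longrightarrow> similarity s f" "0 \<le> s" "s < 1" "solution F X" "solution F Y"
  shows "Y = X"
proof
  fix j
  have "X j \<subseteq> Y j" "Y j \<subseteq> X j"
    using solution_unique_subset [of F s] assms by blast+
  then show "Y j = X j" by blast
qed

lemma tile_substitutionI:
  assumes "\<And>i j. finite (F i j)" "\<And>i j f. f \<in> F i j \<Longrightarrow> similarity (1 / tau) f"
    and "solution F X"
    and "\<And>j i i' f f'. f \<in> F i j \<Longrightarrow> f' \<in> F i' j \<Longrightarrow> (i, f) \<noteq> (i', f') \<Longrightarrow>
      interior (f ` X i) \<inter> interior (f' ` X i') = {}"
  shows "tile_substitution F X"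
proof -
  have pos: "0 \<le> 1 / tau" "1 / tau < 1" using tau_gt_1 by auto
  have "Y = X" if Y: "solution F Y" for Y
    by (rule solution_unique [where F = F, OF assms(2) pos assms(3) Y])
  then show ?thesis unfolding tile_substitution_def using assms by blast
qed

lemma tile_substitution_transport:
  assumes F: "tile_substitution F X" and s: "s > 0" and g: "\<And>i. similarity s (g i)"
  shows "tile_substitution (transport g F) (\<lambda>i. g i ` X i)"
proof (rule tile_substitutionI)
  have inv: "inv (g i) (g i x) = x" for i x
    using similarity_bij [OF g s] by (simp add: bij_is_inj)
  have im: "(g j \<circ> f \<circ> inv (g i)) ` g i ` X i = g j ` f ` X i" for i j f
    by (simp add: image_image inv)
  show "finite (transport g F i j)" for i j
    using F unfolding tile_substitution_def transport_def by blast
  show "similarity (1 / tau) f" if f: "f \<in> transport g F i j" for i j f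
  proof -
    obtain h where h: "h \<in> F i j" "f = g j \<circ> h \<circ> inv (g i)"
      using f unfolding transport_def by blast
    have "similarity (1 / tau) h" using F h(1) unfolding tile_substitution_def by blast
    from similarity_comp [OF similarity_comp [OF g this] similarity_inv [OF g s]] s
    show ?thesis by (simp add: h(2))
  qed
  have X: "solution F X" using F unfolding tile_substitution_def by blast
  show "solution (transport g F) (\<lambda>i. g i ` X i)"
    unfolding solution_def
  proof (intro allI conjI)
    fix j
    show "compact (g j ` X j)"
      using X g similarity_compact unfolding solution_def by blast
    show "g j ` X j \<noteq> {}" using X unfolding solution_def by blast
    have "(\<Union>i. \<Union>f\<in>transport g F i j. f ` g i ` X i) = (\<Union>i. \<Union>f\<in>F i j. g j ` f ` X i)"
      by (simp only: transport_def UN_simps(10) im)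
    also have "\<dots> = g j ` (\<Union>i. \<Union>f\<in>F i j. f ` X i)" by blast
    also have "(\<Union>i. \<Union>f\<in>F i j. f ` X i) = X j" using X by (rule solution_union [symmetric])
    finally show "g j ` X j = (\<Union>i. \<Union>f\<in>transport g F i j. f ` g i ` X i)" ..
  qed
  fix j i i' f f'
  assume f: "f \<in> transport g F i j" "f' \<in> transport g F i' j" "(i, f) \<noteq> (i', f')"
  obtain h h' where h: "h \<in> F i j" "f = g j \<circ> h \<circ> inv (g i)" "h' \<in> F i' j" "f' = g j \<circ> h' \<circ> inv (g i')"
    using f(1,2) unfolding transport_def by blast
  with f have "(i, h) \<noteq> (i', h')" by auto
  with h F have "interior (h ` X i) \<inter> interior (h' ` X i') = {}"
    unfolding tile_substitution_def by blast
  moreover have "inj (g j)" using similarity_bij [OF g s] by (simp add: bij_is_inj)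
  ultimately show "interior (f ` g i ` X i) \<inter> interior (f' ` g i' ` X i') = {}"
    unfolding h im similarity_interior [OF g s] by (simp flip: image_Int)
qed

section \<open>Dissecting triangles\<close>

lemma point_in_hull:
  fixes a b :: complex
  assumes "0 \<le> t" "t \<le> 1" "a \<in> convex hull S" "b \<in> convex hull S"
  shows "a + of_real t * (b - a) \<in> convex hull S"
proof -
  have "a + of_real t * (b - a) = (1 - t) *\<^sub>R a + t *\<^sub>R b"
    by (simp add: scaleR_conv_of_real algebra_simps)
  moreover have "\<dots> \<in> convex hull S"
    using assms by (intro convexD [OF convex_convex_hull]) auto
  ultimately show ?thesis by simp
qed

lemma triangle_split:
  fixes a b c :: complex
  assumes t: "0 < t" "t < 1" and m: "m = a + of_real t * (b - a)"
  shows "convex hull {a, b, c} = convex hull {a, m, c} \<union> convex hull {m, b, c}"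
proof
  have "m \<in> convex hull {a, b, c}"
    unfolding m using t by (intro point_in_hull) (auto intro: hull_inc)
  then have "{a, m, c} \<subseteq> convex hull {a, b, c}" "{m, b, c} \<subseteq> convex hull {a, b, c}"
    by (auto intro: hull_inc)
  then show "convex hull {a, m, c} \<union> convex hull {m, b, c} \<subseteq> convex hull {a, b, c}"
    by (simp add: hull_minimal convex_convex_hull)
  show "convex hull {a, b, c} \<subseteq> convex hull {a, m, c} \<union> convex hull {m, b, c}"
  proof
    fix x assume "x \<in> convex hull {a, b, c}"
    then obtain u v w where x: "x = u *\<^sub>R a + v *\<^sub>R b + w *\<^sub>R c"
      and uvw: "0 \<le> u" "0 \<le> v" "0 \<le> w" "u + v + w = 1"
      unfolding convex_hull_3 by auto
    have m': "m = (1 - t) *\<^sub>R a + t *\<^sub>R b"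
      by (simp add: m scaleR_conv_of_real algebra_simps)
    show "x \<in> convex hull {a, m, c} \<union> convex hull {m, b, c}"
    \<comment> \<open>Equality describes the line through \<open>c\<close> and \<open>m\<close>,
      since \<open>m\<close> has weights \<open>1 - t\<close> and \<open>t\<close>; the two cases
      are its sides, and the weights of \<open>a\<close> and \<open>b\<close> are rewritten with the
      help of \<open>m\<close>.\<close>
    proof (cases "v * (1 - t) \<le> u * t")
      case True
      define v' where "v' = v / t"
      have v: "v = v' * t" using t by (simp add: v'_def)
      have "x = (u - v' * (1 - t)) *\<^sub>R a + v' *\<^sub>R m + w *\<^sub>R c"
        unfolding x m' v by (simp add: algebra_simps)
      moreover have "0 \<le> u - v' * (1 - t)" "0 \<le> v'"
        using True t uvw by (simp_all add: v'_def field_simps)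
      moreover have "(u - v' * (1 - t)) + v' + w = 1"
        using uvw(4) v by (simp add: algebra_simps)
      ultimately show ?thesis using uvw unfolding convex_hull_3 by blast
    next
      case False
      define u' where "u' = u / (1 - t)"
      have u: "u = u' * (1 - t)" using t by (simp add: u'_def)
      have "x = u' *\<^sub>R m + (v - u' * t) *\<^sub>R b + w *\<^sub>R c"
        unfolding x m' u by (simp add: algebra_simps)
      moreover have "0 \<le> v - u' * t" "0 \<le> u'"
        using False t uvw by (simp_all add: u'_def field_simps)
      moreover have "u' + (v - u' * t) + w = 1"
        using uvw(4) u by (simp add: algebra_simps)
      ultimately show ?thesis using uvw unfolding convex_hull_3 by blast
    qed
  qed
qed

lemma triangle_split_interior:
  fixes a b c :: complex
  assumes t: "0 < t" "t < 1" and m: "m = a + of_real t * (b - a)" "m \<noteq> c"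
  shows "interior (convex hull {a, m, c}) \<inter> interior (convex hull {m, b, c}) = {}"
proof -
  have *: ?thesis if n: "n \<noteq> 0" "n \<bullet> c = n \<bullet> m" "n \<bullet> (b - a) \<ge> 0" for n
  proof -
    have nm: "n \<bullet> m = n \<bullet> a + t * (n \<bullet> (b - a))"
      by (simp add: m inner_add_right flip: scaleR_conv_of_real)
    have "t * (n \<bullet> (b - a)) \<ge> 0" "t * (n \<bullet> (b - a)) \<le> n \<bullet> (b - a)"
      using t n(3) by (auto intro: mult_left_le_one_le)
    with nm have "n \<bullet> a \<le> n \<bullet> m" "n \<bullet> m \<le> n \<bullet> b" by (simp_all add: inner_diff_right)
    then have "{a, m, c} \<subseteq> {x. n \<bullet> x \<le> n \<bullet> m}" "{m, b, c} \<subseteq> {x. n \<bullet> x \<ge> n \<bullet> m}"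
      using n(2) by auto
    then have hulls: "convex hull {a, m, c} \<subseteq> {x. n \<bullet> x \<le> n \<bullet> m}"
      "convex hull {m, b, c} \<subseteq> {x. n \<bullet> x \<ge> n \<bullet> m}"
      by (simp_all only: hull_minimal convex_halfspace_le convex_halfspace_ge)
    from hulls have "convex hull {a, m, c} \<inter> convex hull {m, b, c} \<subseteq> {x. n \<bullet> x = n \<bullet> m}" by force
    then have "interior (convex hull {a, m, c} \<inter> convex hull {m, b, c}) \<subseteq> {}"
      using interior_mono interior_hyperplane [OF n(1)] by metis
    then show ?thesis by simp
  qed
  \<comment> \<open>A normal of the cutting line, obtained by a quarter turn. One of
    \<open>n\<close> and \<open>- n\<close> has \<open>b\<close> on its nonnegative side, so the
    line separates the pieces and their intersection lies in a line with empty interior.\<close>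
  define n where "n = \<i> * (c - m)"
  have n: "n \<noteq> 0" "n \<bullet> c = n \<bullet> m" "- n \<bullet> c = - n \<bullet> m"
    using m(2) by (simp_all add: n_def inner_complex_def algebra_simps)
  show ?thesis
  proof (cases "n \<bullet> (b - a) \<ge> 0")
    case True
    with n * show ?thesis by blast
  next
    case False
    then have "- n \<bullet> (b - a) \<ge> 0" by simp
    with n(1,3) * [of "- n"] show ?thesis by simp
  qed
qed

section \<open>Labelled triangles and the choice of the Tuebingen prototiles\<close>

lemma carry_transport:
  assumes s: "s > 0" and g: "similarity s g" and h: "similarity s h"
  shows "carry (g u) (g v) (g w) (h u') (h v') (h w') = (\<lambda>f. h \<circ> f \<circ> inv g) ` carry u v w u' v' w'"
proof -
  have b: "bij g" "bij h" using similarity_bij s g h by blast+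
  have inv: "inv g (g x) = x" "inv h (h x) = x" "g (inv g x) = x" "h (inv h x) = x" for x
    using b by (simp_all add: bij_is_inj bij_is_surj surj_f_inv_f)
  have "f \<in> (\<lambda>f. h \<circ> f \<circ> inv g) ` carry u v w u' v' w'"
    if f: "f \<in> carry (g u) (g v) (g w) (h u') (h v') (h w')" for f
  proof
    have sim: "similarity (1 / tau) f" using f by (simp add: carry_def)
    show "f = h \<circ> (inv h \<circ> f \<circ> g) \<circ> inv g" by (simp add: fun_eq_iff inv)
    show "inv h \<circ> f \<circ> g \<in> carry u v w u' v' w'"
      using similarity_comp [OF similarity_comp [OF similarity_inv [OF h s] sim] g] f s
      by (simp add: carry_def inv)
  qed
  moreover have "h \<circ> f \<circ> inv g \<in> carry (g u) (g v) (g w) (h u') (h v') (h w')"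
    if f: "f \<in> carry u v w u' v' w'" for f
  proof -
    have sim: "similarity (1 / tau) f" using f by (simp add: carry_def)
    show ?thesis
      using similarity_comp [OF similarity_comp [OF h sim] similarity_inv [OF g s]] f s
      by (simp add: carry_def inv)
  qed
  ultimately show ?thesis by blast
qed

text \<open>The ratio \<open>(w - u) / (v - u)\<close> is kept by orientation preserving
  similarities and conjugated by reversing ones. As it is not real, the images of the vertices
  decide the orientation, and then the coefficients.\<close>

lemma carry_eq:
  assumes f: "similarity (1 / tau) f" "f u = u'" "f v = v'" "f w = w'"
    and ncol: "Im ((w - u) / (v - u)) \<noteq> 0"
  shows "carry u v w u' v' w' = {f}"
proof -
  have pos: "1 / tau > 0" using tau_pos by simp
  obtain c \<alpha> \<beta> where 1: "\<alpha> \<noteq> 0" "f = sim_map c \<alpha> \<beta>"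
    using f(1) pos by (elim similarity_cases)
  have *: "h = f" if h: "similarity (1 / tau) h" "h u = f u" "h v = f v" "h w = f w" for h
  proof -
    obtain c' \<alpha>' \<beta>' where 2: "\<alpha>' \<noteq> 0" "h = sim_map c' \<alpha>' \<beta>'"
      using h(1) pos by (elim similarity_cases)
    have v: "\<alpha>' * cnj_if c' (v - u) = \<alpha> * cnj_if c (v - u)"
      and w: "\<alpha>' * cnj_if c' (w - u) = \<alpha> * cnj_if c (w - u)"
      using h(2-4) unfolding 1 2 sim_map_diff [of c' \<alpha>' \<beta>', symmetric]
        sim_map_diff [of c \<alpha> \<beta>, symmetric]
      by simp_all
    have ne: "v - u \<noteq> 0" using ncol by auto
    have "cnj_if c' ((w - u) / (v - u)) = (\<alpha>' * cnj_if c' (w - u)) / (\<alpha>' * cnj_if c' (v - u))"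
      using 2 by (simp del: cnj_if_simps(2))
    also have "\<dots> = cnj_if c ((w - u) / (v - u))"
      unfolding v w using 1 by (simp del: cnj_if_simps(2))
    finally have eq: "cnj_if c' ((w - u) / (v - u)) = cnj_if c ((w - u) / (v - u))" .
    have "c = c'"
      using arg_cong [OF eq, of Im] ncol
      by (cases c; cases c') (simp_all add: cnj_if_def del: complex_cnj_divide complex_cnj_diff)
    with v ne have "\<alpha> = \<alpha>'" by (simp del: cnj_if_simps(2))
    with h(2) \<open>c = c'\<close> have "\<beta> = \<beta>'" unfolding 1 2 by (simp add: sim_map_eq)
    with \<open>\<alpha> = \<alpha>'\<close> \<open>c = c'\<close> show ?thesis by (simp add: 1 2)
  qed
  show ?thesis unfolding carry_def f(2-4) [symmetric] using f(1) * by blast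
qed

text \<open>Side-side-side: the side lengths give the moduli of \<open>k\<close> and
  \<open>k - 1\<close>, where \<open>k\<close> is the position of the third vertex relative to the
  first two. These determine \<open>k\<close> up to conjugation, and the conjugation is absorbed
  into the orientation of \<open>g\<close>.\<close>

lemma triangle_similarity:
  assumes uv: "u \<noteq> v" and s: "s > 0"
    and d: "dist u' v' = s * dist u v" "dist u' w' = s * dist u w" "dist v' w' = s * dist v w"
  shows "\<exists>g. similarity s g \<and> g u = u' \<and> g v = v' \<and> g w = w'"
proof -
  have uv': "u' \<noteq> v'" using d(1) uv s by auto
  define k where "k = (w - u) / (v - u)"
  define k' where "k' = (w' - u') / (v' - u')"
  have w: "w = u + k * (v - u)" "w' = u' + k' * (v' - u')"
    using uv uv' by (simp_all add: k_def k'_def)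
  have "cmod k = cmod k'"
    using d s uv by (simp add: k_def k'_def norm_divide dist_norm norm_minus_commute)
  moreover have "cmod (k - 1) = cmod (k' - 1)"
  proof -
    have "k - 1 = (w - v) / (v - u)" "k' - 1 = (w' - v') / (v' - u')"
      using uv uv' by (simp_all add: k_def k'_def field_simps)
    then show ?thesis
      using d s uv by (simp add: norm_divide dist_norm norm_minus_commute)
  qed
  ultimately have "(cmod k)\<^sup>2 = (cmod k')\<^sup>2" "(cmod (k - 1))\<^sup>2 = (cmod (k' - 1))\<^sup>2" by simp_all
  then have eqs: "(Re k)\<^sup>2 + (Im k)\<^sup>2 = (Re k')\<^sup>2 + (Im k')\<^sup>2"
    "(Re k)\<^sup>2 + (Im k)\<^sup>2 - 2 * Re k = (Re k')\<^sup>2 + (Im k')\<^sup>2 - 2 * Re k'"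
    by (simp_all add: cmod_power2 power2_diff)
  then have "Re k = Re k'" by linarith
  moreover from this eqs have "(Im k)\<^sup>2 = (Im k')\<^sup>2" by simp
  ultimately have "k' = k \<or> k' = cnj k" by (auto simp: complex_eq_iff power2_eq_iff)
  then obtain c where k': "k' = cnj_if c k" unfolding cnj_if_def by (metis (full_types))
  define \<alpha> where "\<alpha> = (v' - u') / cnj_if c (v - u)"
  have v: "v' - u' = \<alpha> * cnj_if c (v - u)"
    using uv by (simp add: \<alpha>_def del: cnj_if_simps(2))
  define g where "g = sim_map c \<alpha> (u' - \<alpha> * cnj_if c u)"
  have gu: "g u = u'" by (simp add: g_def sim_map_eq)
  have diff: "g x - g u = \<alpha> * cnj_if c (x - u)" for x
    unfolding g_def by (rule sim_map_diff)
  have "g v - u' = v' - u'" unfolding v using diff [of v] gu by simp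
  then have gv: "g v = v'" by simp
  have "g w - u' = \<alpha> * cnj_if c (w - u)" using diff [of w] gu by simp
  also have "w - u = k * (v - u)" using w(1) by simp
  also have "\<alpha> * cnj_if c (k * (v - u)) = k' * (v' - u')"
    unfolding v k' cnj_if_simps(3) by simp
  also have "\<dots> = w' - u'" using w(2) by simp
  finally have gw: "g w = w'" by simp
  have "cmod \<alpha> = s"
    using d(1) s uv by (simp add: \<alpha>_def norm_divide dist_norm norm_minus_commute del: cnj_if_simps(2))
  then have "similarity s g" unfolding g_def by (simp add: similarity_sim_map_iff)
  with gu gv gw show ?thesis by blast
qed

lemma tuebingen_system_transport:
  assumes s: "s > 0" and g: "\<And>i. similarity s (g i)"
  shows "tuebingen_system (g Large p) (g Large q) (g Large r) (g Small a) (g Small b) (g Small c) =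
    transport g (tuebingen_system p q r a b c)"
proof (intro ext)
  fix i j
  show "tuebingen_system (g Large p) (g Large q) (g Large r) (g Small a) (g Small b) (g Small c) i j =
    transport g (tuebingen_system p q r a b c) i j"
    unfolding transport_def
    by (cases i; cases j; simp only: tuebingen_system.simps Let_def image_Un
        carry_transport [OF s g g, symmetric] similarity_affine [OF g s])
qed

lemma tuebingen_tiles_image:
  assumes s: "s > 0" and g: "\<And>i. similarity s (g i)"
  shows "(\<lambda>i. g i ` tuebingen_tiles p q r a b c i) =
    tuebingen_tiles (g Large p) (g Large q) (g Large r) (g Small a) (g Small b) (g Small c)"
proof
  fix i show "g i ` tuebingen_tiles p q r a b c i =
    tuebingen_tiles (g Large p) (g Large q) (g Large r) (g Small a) (g Small b) (g Small c) i"
    by (cases i) (simp_all add: similarity_hull [OF g s])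
qed

lemma acute_similarity:
  assumes "similarity s g" "s > 0" "acute p q r"
  shows "acute (g p) (g q) (g r)"
proof -
  have d: "dist (g x) (g y) = s * dist x y" for x y
    using assms(1) unfolding similarity_def by blast
  have "g q \<noteq> g r" using d [of q r] assms(2,3) by (auto simp: acute_def)
  then show ?thesis using assms(3) unfolding acute_def d by simp
qed

lemma obtuse_similarity:
  assumes "similarity s g" "s > 0" "obtuse a b c"
  shows "obtuse (g a) (g b) (g c)"
proof -
  have d: "dist (g x) (g y) = s * dist x y" for x y
    using assms(1) unfolding similarity_def by blast
  have "g a \<noteq> g c" using d [of a c] assms(2,3) by (auto simp: obtuse_def)
  then show ?thesis using assms(3) unfolding obtuse_def d by simp
qed

text \<open>All admissible choices of labelled prototiles form a single orbit under moves, because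
  each triangle is fixed by its side ratios; hence the tile conditions need checking for one choice
  only.\<close>

lemma tuebingen_eq:
  assumes T: "acute p q r" "obtuse a b c" "dist a c = dist q r"
    and sub: "tile_substitution (tuebingen_system p q r a b c) (tuebingen_tiles p q r a b c)"
  shows "tuebingen = {G. same_substitution (tuebingen_system p q r a b c) G}"
proof (intro equalityI subsetI CollectI; (elim CollectE)?)
  fix G assume "same_substitution (tuebingen_system p q r a b c) G"
  then obtain s g where s: "s > 0" and g: "\<And>i. similarity s (g i)"
    and G: "G = transport g (tuebingen_system p q r a b c)"
    unfolding same_substitution_iff by blast
  let ?P = "\<lambda>x. g Large x" and ?A = "\<lambda>x. g Small x"
  have "acute (?P p) (?P q) (?P r)" "obtuse (?A a) (?A b) (?A c)"
    using acute_similarity obtuse_similarity g s T by blast+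
  moreover have "dist (?A a) (?A c) = dist (?P q) (?P r)"
    using g [of Small] g [of Large] T(3) by (simp add: similarity_def)
  moreover have "G = tuebingen_system (?P p) (?P q) (?P r) (?A a) (?A b) (?A c)"
    unfolding G using tuebingen_system_transport [of s g, OF s g] by simp
  moreover have "tile_substitution G (tuebingen_tiles (?P p) (?P q) (?P r) (?A a) (?A b) (?A c))"
    using tile_substitution_transport [of _ _ s g, OF sub s g]
    unfolding G tuebingen_tiles_image [of s g, OF s g] .
  ultimately show "G \<in> tuebingen" unfolding tuebingen_def by blast
next
  fix G assume "G \<in> tuebingen"
  then obtain p' q' r' a' b' c' where G: "acute p' q' r'" "obtuse a' b' c'" "dist a' c' = dist q' r'"
    "G = tuebingen_system p' q' r' a' b' c'"
    unfolding tuebingen_def by blast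
  \<comment> \<open>The ratio is read off the acute triangles; \<open>dist a c = dist q r\<close>
    and its primed version make it the ratio of the obtuse ones too.\<close>
  define s where "s = dist q' r' / dist q r"
  have qr: "dist q r > 0" "dist q' r' = s * dist q r" using T by (simp_all add: s_def acute_def)
  have s: "s > 0" using T G by (simp add: s_def acute_def)
  have "\<exists>g. similarity s g \<and> g q = q' \<and> g r = r' \<and> g p = p'"
    using T(1) G(1) s qr
    by (intro triangle_similarity) (simp_all add: acute_def dist_commute)
  then obtain gL where gL: "similarity s gL" "gL q = q'" "gL r = r'" "gL p = p'" by blast
  have "\<exists>g. similarity s g \<and> g a = a' \<and> g c = c' \<and> g b = b'"
    using T(2,3) G(2,3) s qr
    by (intro triangle_similarity) (simp_all add: obtuse_def dist_commute)
  then obtain gS where gS: "similarity s gS" "gS a = a'" "gS c = c'" "gS b = b'" by blast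
  define g where "g = case_tile gS gL"
  have g: "similarity s (g i)" for i using gL gS by (cases i) (simp_all add: g_def)
  have "G = transport g (tuebingen_system p q r a b c)"
    using tuebingen_system_transport [of s g p q r a b c, OF s g] gL gS G(4) by (simp add: g_def)
  with s g show "same_substitution (tuebingen_system p q r a b c) G"
    by (rule same_substitutionI)
qed

section \<open>The Penrose substitution and its dual\<close>

text \<open>Two successive cuts: from \<open>c\<close> to \<open>m\<close> on the side
  \<open>a b\<close>, then the remaining triangle from \<open>m\<close> to \<open>n\<close> on the
  side \<open>b c\<close>.\<close>

lemma triangle_split_3:
  fixes a b c :: complex
  assumes t: "0 < t" "t < 1" and m: "m = a + of_real t * (b - a)" "m \<noteq> c"
    and u: "0 < u" "u < 1" and n: "n = b + of_real u * (c - b)" "n \<noteq> m"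
  shows "convex hull {a, b, c} = convex hull {c, a, m} \<union> convex hull {b, m, n} \<union> convex hull {c, m, n}"
    and "interior (convex hull {c, a, m}) \<inter> interior (convex hull {b, m, n}) = {}"
    and "interior (convex hull {c, a, m}) \<inter> interior (convex hull {c, m, n}) = {}"
    and "interior (convex hull {b, m, n}) \<inter> interior (convex hull {c, m, n}) = {}"
proof -
  note split = triangle_split [OF t m(1), of c] triangle_split [OF u n(1), of m]
  have perm: "{a, m, c} = {c, a, m}" "{m, b, c} = {b, c, m}" "{b, n, m} = {b, m, n}"
    "{n, c, m} = {c, m, n}" by auto
  show "convex hull {a, b, c} = convex hull {c, a, m} \<union> convex hull {b, m, n} \<union> convex hull {c, m, n}"
    using split unfolding perm by (simp add: Un_assoc)
  have bcm: "convex hull {b, m, n} \<subseteq> convex hull {b, c, m}"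
    "convex hull {c, m, n} \<subseteq> convex hull {b, c, m}"
    using split(2) unfolding perm by blast+
  show "interior (convex hull {c, a, m}) \<inter> interior (convex hull {b, m, n}) = {}"
    "interior (convex hull {c, a, m}) \<inter> interior (convex hull {c, m, n}) = {}"
    using triangle_split_interior [OF t m] interior_mono [OF bcm(1)] interior_mono [OF bcm(2)]
    unfolding perm by blast+
  show "interior (convex hull {b, m, n}) \<inter> interior (convex hull {c, m, n}) = {}"
    using triangle_split_interior [OF u n] unfolding perm .
qed

text \<open>Both substitutions cut their triangles in the same way and differ only in how the pieces are
  placed.\<close>

lemma tile_substitution_triangles:
  assumes F: "F Large Large = {f, f'}" "F Small Large = {h}" "F Small Small = {k}"
      "F Large Small = {l}"
    and sim: "\<And>i j f. f \<in> F i j \<Longrightarrow> similarity (1 / tau) f"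
    and X: "X Large = convex hull {a, b, c}" "X Small = convex hull {u, v, w}"
    and m: "m = a + of_real (1 / tau\<^sup>2) * (b - a)" "m \<noteq> c"
    and n: "n = b + of_real (1 / tau) * (c - b)" "n \<noteq> m"
    and e: "e = u + of_real (1 / tau\<^sup>2) * (v - u)" "e \<noteq> w"
    and L: "f ` {a, b, c} = {c, a, m}" "f' ` {a, b, c} = {b, m, n}" "h ` {u, v, w} = {c, m, n}"
    and S: "k ` {u, v, w} = {w, u, e}" "l ` {a, b, c} = {v, w, e}"
  shows "tile_substitution F X"
proof -
  have pos: "0 < 1 / tau" "1 / tau < 1" "0 < 1 / tau\<^sup>2" "1 / tau\<^sup>2 < 1"
    using tau_gt_1 by simp_all
  have sims: "similarity (1 / tau) f" "similarity (1 / tau) f'" "similarity (1 / tau) h"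
    "similarity (1 / tau) k" "similarity (1 / tau) l"
    using sim [of f Large Large] sim [of f' Large Large] sim [of h Small Large]
      sim [of k Small Small] sim [of l Large Small] F by simp_all
  have img: "f ` X Large = convex hull {c, a, m}" "f' ` X Large = convex hull {b, m, n}"
    "h ` X Small = convex hull {c, m, n}" "k ` X Small = convex hull {w, u, e}"
    "l ` X Large = convex hull {v, w, e}"
    unfolding X by (simp_all only: similarity_hull [OF _ pos(1)] sims L S)
  have perm: "{u, e, w} = {w, u, e}" "{e, v, w} = {v, w, e}" by auto
  note large = triangle_split_3 [OF pos(3,4) m pos(1,2) n]
  note small = triangle_split [OF pos(3,4) e(1), of w, unfolded perm]
    triangle_split_interior [OF pos(3,4) e, unfolded perm]
  have UNIV_tile: "UNIV = {Small, Large}" using tile.exhaust by blast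
  have UN: "(\<Union>i. A i) = A Small \<union> A Large" for A :: "tile \<Rightarrow> complex set"
    unfolding UNIV_tile by simp
  show ?thesis
  proof (rule tile_substitutionI)
    show "finite (F i j)" for i j by (cases i; cases j) (simp_all add: F)
    show "solution F X"
      unfolding solution_def
    proof (intro allI conjI)
      fix j
      show "compact (X j)" by (cases j) (simp_all add: X finite_imp_compact_convex_hull)
      show "X j \<noteq> {}" by (cases j) (simp_all add: X)
      have "X Large = (\<Union>f\<in>F Small Large. f ` X Small) \<union> (\<Union>f\<in>F Large Large. f ` X Large)"
        unfolding F by (simp only: UN_insert UN_empty img) (use X(1) large(1) in blast)
      moreover have "X Small = (\<Union>f\<in>F Small Small. f ` X Small) \<union> (\<Union>f\<in>F Large Small. f ` X Large)"
        unfolding F by (simp only: UN_insert UN_empty img) (use X(2) small(1) in blast)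
      ultimately show "X j = (\<Union>i. \<Union>f\<in>F i j. f ` X i)"
        unfolding UN by (cases j) (simp_all only:)
    qed
    fix j i i' g g'
    assume g: "g \<in> F i j" "g' \<in> F i' j" "(i, g) \<noteq> (i', g')"
    note dis = large(2-4) small(2)
    show "interior (g ` X i) \<inter> interior (g' ` X i') = {}"
      using g dis dis [THEN trans [OF Int_commute]]
      by (cases j; cases i; cases i') (auto simp: F img)
  qed (rule sim)
qed

section \<open>Coefficients of the Penrose maps and of their duals\<close>

lemma of_real_inverse_tau_square: "complex_of_real (1 / tau\<^sup>2) = 1 - xi - xi ^ 4"
proof -
  have "1 / tau\<^sup>2 = 1 - 1 / tau"
    using tau_pos tau_square by (simp add: field_simps power2_eq_square)
  then show ?thesis by (simp only: of_real_diff of_real_inverse_tau) simp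
qed

lemma cmod_xi: "cmod xi = 1"
  by (simp add: xi_eq_cis)

lemma xi_neq: "xi \<noteq> 0" "xi \<noteq> 1"
  using Im_xi_pos by auto

lemma cmod_xi_plus_xi_4: "cmod (xi + xi ^ 4) = 1 / tau"
  unfolding of_real_inverse_tau [symmetric] norm_of_real using tau_pos by simp

text \<open>The number inside is the image of \<open>xi + xi^4\<close> under \<open>star_aut\<close>
  and equals \<open>- tau\<close>. Hence \<open>star_map\<close> makes the Penrose maps expand by
  \<open>tau\<close>, and their inverses contract as required.\<close>

lemma cmod_xi_3_plus_xi_2: "cmod (xi ^ 3 + xi ^ 2) = tau"
proof -
  have "1 + xi + xi ^ 4 = complex_of_real (1 + 1 / tau)"
    by (simp only: of_real_add of_real_inverse_tau) simp
  also have "1 + 1 / tau = tau" by (simp add: inverse_tau)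
  finally have "1 + xi + xi ^ 4 = complex_of_real tau" .
  moreover have "xi ^ 3 + xi ^ 2 = - (1 + xi + xi ^ 4)"
    using xi_cyclotomic by algebra
  ultimately show ?thesis using tau_pos by simp
qed

lemma xi_sums_neq_0: "xi + xi ^ 4 \<noteq> 0" "xi ^ 3 + xi ^ 2 \<noteq> 0"
  using cmod_xi_plus_xi_4 cmod_xi_3_plus_xi_2 tau_pos by auto

lemmas xi_nonzero_simps = mult_eq_0_iff neg_equal_0_iff_equal power_eq_0_iff xi_neq(1) xi_sums_neq_0
  zero_neq_one [symmetric] simp_thms

lemmas Q_xi_closed = Q_xi.xi Q_xi.one Q_xi.diff Q_xi.mult Q_xi_add Q_xi_minus Q_xi_power

lemma penrose_maps_in_Q_xi_maps:
  "f1 \<in> Q_xi_maps" "f2 \<in> Q_xi_maps" "f3 \<in> Q_xi_maps" "f4 \<in> Q_xi_maps" "f5 \<in> Q_xi_maps"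
  unfolding f1_def f2_def f3_def f4_def f5_def
  by (intro Q_xi_mapsI Q_xi_closed; simp only: xi_nonzero_simps)+

lemma similarity_penrose_maps:
  "similarity (1 / tau) f1" "similarity (1 / tau) f2" "similarity (1 / tau) f3"
  "similarity (1 / tau) f4" "similarity (1 / tau) f5"
  unfolding f1_def f2_def f3_def f4_def f5_def similarity_sim_map_iff norm_mult
  by (simp_all add: cmod_xi_plus_xi_4 cmod_xi norm_power)

lemma star_aut_xi_powers:
  "star_aut (xi ^ 2) = xi" "star_aut (xi ^ 3) = xi ^ 4" "star_aut (xi ^ 4) = xi ^ 2"
  unfolding star_aut_power [OF Q_xi.xi] star_aut_xi
  using xi_pow_5 by algebra+

lemma star_map_penrose_maps:
  "star_map f1 = sim_map False ((xi^3 + xi^2) * (- (xi^2))) (- 1 - xi^4)"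
  "star_map f2 = sim_map False ((xi^3 + xi^2) * (- (xi^3))) (- 1 - xi^4 - xi^2)"
  "star_map f3 = sim_map False ((xi^3 + xi^2) * xi^4) (1 + xi^3)"
  "star_map f4 = sim_map True ((xi^3 + xi^2) * (- xi)) (1 - xi^4)"
  "star_map f5 = sim_map True ((xi^3 + xi^2) * (- 1)) (1 - xi - xi^4)"
  unfolding f1_def f2_def f3_def f4_def f5_def
  by (subst star_map_sim_map, simp only: xi_nonzero_simps,
      simp only: star_aut_add star_aut_diff star_aut_mult star_aut_minus star_aut_1 star_aut_xi
        star_aut_xi_powers Q_xi_closed)+

lemma sharp_eq_inv_star_map: "f \<in> Q_xi_maps \<Longrightarrow> sharp f = inv (star_map f)"
  by (simp add: sharp_eq star_map_inv)

lemma sharp_in: "f \<in> Q_xi_maps \<Longrightarrow> sharp f \<in> Q_xi_maps"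
  by (simp add: sharp_eq star_map_in Q_xi_maps_inv)

text \<open>Lets values of \<open>sharp f\<close> be verified through \<open>star_map f\<close>, so
  that the coefficients of the inverse are never computed.\<close>

lemma sharp_eqI: "f \<in> Q_xi_maps \<Longrightarrow> star_map f y = x \<Longrightarrow> sharp f x = y"
  using Q_xi_maps_bij [OF star_map_in] sharp_eq_inv_star_map
  by (metis bij_inv_eq_iff)

lemma star_map_star_map:
  assumes "f \<in> Q_xi_maps"
  shows "star_map (star_map f) = cnj \<circ> f \<circ> cnj"
proof -
  obtain c \<alpha> \<beta> where f: "\<alpha> \<in> Q_xi" "\<beta> \<in> Q_xi" "\<alpha> \<noteq> 0" "f = sim_map c \<alpha> \<beta>"
    using assms by (elim Q_xi_mapsE)
  then have "star_map (star_map f) = sim_map c (cnj \<alpha>) (cnj \<beta>)"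
    by (simp add: star_map_sim_map star_aut_eq_0_iff star_aut_star_aut)
  also have "\<dots> = cnj \<circ> f \<circ> cnj" unfolding f(4) by (simp add: fun_eq_iff sim_map_def)
  finally show ?thesis .
qed

lemma sharp_sharp:
  assumes "f \<in> Q_xi_maps"
  shows "sharp (sharp f) = cnj \<circ> f \<circ> cnj"
proof -
  have "inv (sharp f) = star_map f"
    using assms sharp_eq_inv_star_map Q_xi_maps_bij [OF star_map_in] by (simp add: inv_inv_eq)
  then show ?thesis using assms by (simp add: sharp_eq [of "sharp f"] star_map_star_map)
qed

lemma same_substitution_dual_dual:
  assumes "over_Q_xi F"
  shows "same_substitution (dual_system (dual_system F)) F"
proof (rule same_substitution_sym, rule same_substitutionI)
  show "similarity 1 cnj" by (simp add: similarity_def dist_norm flip: complex_cnj_diff)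
  have "inv cnj = cnj" by (intro inv_unique_comp) (simp_all add: fun_eq_iff)
  have *: "f \<in> F i j \<Longrightarrow> sharp (sharp f) = cnj \<circ> f \<circ> cnj" for i j f
    using assms sharp_sharp unfolding over_Q_xi_iff by blast
  show "dual_system (dual_system F) = transport (\<lambda>i. cnj) F"
    unfolding dual_system_def transport_def image_image \<open>inv cnj = cnj\<close>
    by (intro ext image_cong refl *)
qed simp

lemma over_Q_xi_penrose: "over_Q_xi penrose_system"
  unfolding over_Q_xi_iff
proof (intro allI)
  fix i j show "penrose_system i j \<subseteq> Q_xi_maps"
    by (cases i; cases j) (simp_all add: penrose_maps_in_Q_xi_maps)
qed

lemma over_Q_xi_dual:
  assumes "over_Q_xi F"
  shows "over_Q_xi (dual_system F)"
  using assms sharp_in unfolding over_Q_xi_iff dual_system_def by blast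

lemma similarity_sharp_penrose_maps:
  "similarity (1 / tau) (sharp f1)" "similarity (1 / tau) (sharp f2)"
  "similarity (1 / tau) (sharp f3)" "similarity (1 / tau) (sharp f4)"
  "similarity (1 / tau) (sharp f5)"
  unfolding sharp_eq_inv_star_map [OF penrose_maps_in_Q_xi_maps(1)]
    sharp_eq_inv_star_map [OF penrose_maps_in_Q_xi_maps(2)]
    sharp_eq_inv_star_map [OF penrose_maps_in_Q_xi_maps(3)]
    sharp_eq_inv_star_map [OF penrose_maps_in_Q_xi_maps(4)]
    sharp_eq_inv_star_map [OF penrose_maps_in_Q_xi_maps(5)] star_map_penrose_maps
  by (rule similarity_inv;
      simp only: tau_pos similarity_sim_map_iff norm_mult norm_minus_cancel norm_power norm_one
        cmod_xi cmod_xi_3_plus_xi_2 power_one mult_1_right)+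

section \<open>The Penrose triangles\<close>

lemma penrose_maps_at_vertices:
  "f1 0 = - 1 - xi^3" "f1 (xi + xi^2) = - 1" "f1 (- 1) = 0"
  "f2 0 = xi + xi^2" "f2 (1 - xi^2 - xi^3) = - 1" "f2 (1 + xi) = - 1 - xi^3"
  "f3 0 = 1 + xi" "f3 (1 - xi^2 - xi^3) = 0" "f3 (1 + xi) = 1"
  "f4 0 = 1 - xi^3" "f4 (xi + xi^2) = 1" "f4 (- 1) = 1 + xi"
  "f5 0 = 1 - xi^2 - xi^3" "f5 (1 - xi^2 - xi^3) = 1" "f5 (1 + xi) = 1 - xi^3"
  unfolding f1_def f2_def f3_def f4_def f5_def sim_map_def if_True if_False
    complex_cnj_add complex_cnj_diff complex_cnj_minus complex_cnj_power complex_cnj_one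
    complex_cnj_zero cnj_xi
  using xi_cyclotomic by ((simp; fail) | algebra)+

text \<open>The acute triangle has apex \<open>xi + xi^2\<close> and sides \<open>tau\<close>,
  \<open>tau\<close>, 1; the obtuse one has apex \<open>1 + xi\<close> and sides \<open>tau\<close>,
  \<open>tau\<close>, \<open>tau\<^sup>2\<close>, its base lying on the real axis because
  \<open>1 - xi^2 - xi^3\<close> equals \<open>tau\<^sup>2\<close>.\<close>

definition penrose_tiles :: "tile \<Rightarrow> complex set" where
  "penrose_tiles = case_tile (convex hull {0, xi + xi^2, - 1})
    (convex hull {0, 1 - xi^2 - xi^3, 1 + xi})"

lemma xi_power_neq: "xi ^ 3 \<noteq> 0" "xi ^ 3 \<noteq> xi ^ 4"
  using xi_neq by (auto simp: eval_nat_numeral)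

lemma tile_substitution_penrose: "tile_substitution penrose_system penrose_tiles"
proof (rule tile_substitution_triangles)
  show "similarity (1 / tau) f" if "f \<in> penrose_system i j" for i j f
    using that similarity_penrose_maps by (cases i; cases j) auto
  show "1 = 0 + of_real (1 / tau\<^sup>2) * (1 - xi^2 - xi^3 - 0)"
    "1 - xi^3 = 1 - xi^2 - xi^3 + of_real (1 / tau) * (1 + xi - (1 - xi^2 - xi^3))"
    "- 1 - xi^3 = 0 + of_real (1 / tau\<^sup>2) * (xi + xi^2 - 0)"
    unfolding of_real_inverse_tau of_real_inverse_tau_square using xi_cyclotomic by algebra+
  show "1 \<noteq> 1 + xi" "1 - xi^3 \<noteq> 1" "- 1 - xi^3 \<noteq> - 1"
    using xi_neq xi_power_neq by simp_all
qed (auto simp: penrose_tiles_def penrose_maps_at_vertices)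

lemma rigid_penrose: "rigid penrose_system"
proof -
  \<comment> \<open>The point is \<open>tau\<close>: on the real axis \<open>f5\<close> is
    \<open>x \<mapsto> tau\<^sup>2 - x / tau\<close>.\<close>
  have fixed: "f5 (1 + xi + xi^4) = 1 + xi + xi^4" and "f3 (1 + xi + xi^4) = 1 + xi + xi^3"
    unfolding f3_def f5_def sim_map_def if_True if_False complex_cnj_add complex_cnj_power
      complex_cnj_one cnj_xi
    using xi_cyclotomic by algebra+
  then have "f3 (1 + xi + xi^4) \<noteq> 1 + xi + xi^4" using xi_power_neq by simp
  with fixed show ?thesis
    unfolding rigid_def using over_Q_xi_penrose similarity_penrose_maps by auto
qed

text \<open>The vertices of the tiles of the dual system; \<open>tp\<close> is the fixed point of \<open>f5\<^sup>\<sharp>\<close>.\<close>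

definition tp :: complex where "tp = - xi - xi^4"
definition tq :: complex where "tq = - (xi^2) - xi^4"
definition tr :: complex where "tr = - xi - xi^3"
definition ta :: complex where "ta = xi^2"
definition tb :: complex where "tb = xi^3"
definition tc :: complex where "tc = xi + xi^4 - 1"

lemmas t_defs = tp_def tq_def tr_def ta_def tb_def tc_def

text \<open>These equations also show where the vertices come from: starting at the fixed point
  \<open>tp\<close>, the map \<open>sharp f3\<close> yields \<open>tq\<close> and then
  \<open>tr\<close>, \<open>sharp f4\<close> sends \<open>tp\<close> and \<open>tq\<close> to
  \<open>tb\<close> and \<open>tc\<close>, and \<open>sharp f1\<close> sends \<open>tb\<close> to
  \<open>ta\<close>. The other values are the cut points of the Tuebingen dissection.\<close>

lemma dual_maps_at_vertices:
  "sharp f5 tp = tp" "sharp f5 tq = tp + of_real (1 / tau) * (tr - tp)"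
    "sharp f5 tr = tp + of_real (1 / tau) * (tq - tp)"
  "sharp f3 tp = tq" "sharp f3 tq = tr" "sharp f3 tr = tp + of_real (1 / tau) * (tr - tp)"
  "sharp f2 ta = tp + of_real (1 / tau) * (tr - tp)" "sharp f2 tb = tq"
    "sharp f2 tc = tp + of_real (1 / tau) * (tq - tp)"
  "sharp f1 ta = tc" "sharp f1 tb = ta" "sharp f1 tc = ta + of_real (1 / tau\<^sup>2) * (tb - ta)"
  "sharp f4 tp = tb" "sharp f4 tq = tc" "sharp f4 tr = ta + of_real (1 / tau\<^sup>2) * (tb - ta)"
  unfolding t_defs of_real_inverse_tau of_real_inverse_tau_square
  by (rule sharp_eqI, rule penrose_maps_in_Q_xi_maps,
      unfold star_map_penrose_maps sim_map_def if_True if_False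
        complex_cnj_add complex_cnj_diff complex_cnj_minus complex_cnj_mult complex_cnj_power
        complex_cnj_one cnj_xi,
      use xi_cyclotomic in algebra)+

text \<open>Each quotient of sides is a root of unity up to sign, possibly times
  \<open>1 / tau\<close>, so both the length ratios and the non-real shape ratios can be read
  off.\<close>

lemma tuebingen_vertices:
  "tr - tp = - (xi^2) * (tq - tp)"
  "tr - tq = (xi + xi^4) * (- xi) * (tq - tp)"
  "tc - ta = (xi + xi^4) * (- (xi^3)) * (tb - ta)"
  "tb - tc = xi^4 * (tc - ta)"
  "tc - ta = - (xi^3) * (tr - tq)"
  unfolding t_defs
  using xi_cyclotomic by ((simp add: eval_nat_numeral algebra_simps; fail) | algebra)+

lemma Im_xi_powers: "Im (xi ^ 2) \<noteq> 0" "Im (xi ^ 3) \<noteq> 0"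
proof -
  have "Re (xi + xi ^ 4) = 2 * Re xi" unfolding cnj_xi [symmetric] by simp
  moreover have "Re (xi + xi ^ 4) = 1 / tau" unfolding of_real_inverse_tau [symmetric] by simp
  ultimately have "Re xi \<noteq> 0" using tau_pos by auto
  then show im2: "Im (xi ^ 2) \<noteq> 0" using Im_xi_pos by (simp add: power2_eq_square)
  have eq: "xi ^ 3 = cnj (xi ^ 2)" unfolding complex_cnj_power cnj_xi using xi_pow_5 by algebra
  show "Im (xi ^ 3) \<noteq> 0" unfolding eq cnj.sel using im2 by (simp del: complex_cnj_power)
qed

lemma tuebingen_not_collinear:
  "Im ((tr - tp) / (tq - tp)) \<noteq> 0" "Im ((tc - ta) / (tb - ta)) \<noteq> 0"
proof -
  have "tq - tp = xi * (1 - xi)" "tb - ta = xi\<^sup>2 * (xi - 1)"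
    by (simp_all add: t_defs eval_nat_numeral algebra_simps)
  then have "tq - tp \<noteq> 0" "tb - ta \<noteq> 0" using xi_neq by simp_all
  then have "(tr - tp) / (tq - tp) = - (xi^2)"
    "(tc - ta) / (tb - ta) = of_real (1 / tau) * (- (xi^3))"
    unfolding tuebingen_vertices(1,3) of_real_inverse_tau by simp_all
  then show "Im ((tr - tp) / (tq - tp)) \<noteq> 0" "Im ((tc - ta) / (tb - ta)) \<noteq> 0"
    using Im_xi_powers tau_pos by (simp_all only: Im_complex_of_real) simp_all
qed

lemma tuebingen_triangles:
  "acute tp tq tr" "obtuse ta tb tc" "dist ta tc = dist tq tr"
proof -
  have d: "cmod (tr - tp) = cmod (tq - tp)" "cmod (tr - tq) = cmod (tq - tp) / tau"
    "cmod (tc - ta) = cmod (tb - ta) / tau" "cmod (tb - tc) = cmod (tc - ta)"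
    unfolding tuebingen_vertices(1-4) norm_mult norm_minus_cancel norm_power cmod_xi cmod_xi_plus_xi_4
    by simp_all
  have d5: "cmod (tc - ta) = cmod (tr - tq)"
    unfolding tuebingen_vertices(5) norm_mult norm_minus_cancel norm_power cmod_xi by simp
  have ne: "tr \<noteq> tq" "tc \<noteq> ta"
    using d(2,3) tau_pos tuebingen_not_collinear by auto
  show "acute tp tq tr"
    using d(1,2) ne tau_pos by (simp add: acute_def dist_norm norm_minus_commute field_simps)
  show "obtuse ta tb tc"
    using d(3,4) ne tau_pos by (simp add: obtuse_def dist_norm norm_minus_commute field_simps)
  show "dist ta tc = dist tq tr"
    using d5 by (simp add: dist_norm norm_minus_commute)
qed

text \<open>Neither triangle is degenerate, so every \<open>carry\<close> in the Tuebingen system is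
  a singleton, and its element is recognized by the values of the dual maps at the vertices.\<close>

lemma dual_penrose_eq: "dual_system penrose_system = tuebingen_system tp tq tr ta tb tc"
proof (intro ext)
  note carries = carry_eq [OF _ _ _ _ tuebingen_not_collinear(1)]
    carry_eq [OF _ _ _ _ tuebingen_not_collinear(2)]
  fix i j
  show "dual_system penrose_system i j = tuebingen_system tp tq tr ta tb tc i j"
    unfolding dual_system_def
    by (cases i; cases j)
      (simp_all add: Let_def carries [OF similarity_sharp_penrose_maps(1)]
        carries [OF similarity_sharp_penrose_maps(2)] carries [OF similarity_sharp_penrose_maps(3)]
        carries [OF similarity_sharp_penrose_maps(4)] carries [OF similarity_sharp_penrose_maps(5)]
        dual_maps_at_vertices insert_commute del: of_real_divide of_real_power)
qed

lemma tile_substitution_dual_penrose: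
  "tile_substitution (dual_system penrose_system) (tuebingen_tiles tp tq tr ta tb tc)"
proof -
  let ?r = "tp + of_real (1 / tau) * (tr - tp)" and ?q = "tp + of_real (1 / tau) * (tq - tp)"
    and ?s = "ta + of_real (1 / tau\<^sup>2) * (tb - ta)"
  show ?thesis
  proof (rule tile_substitution_triangles)
    show "similarity (1 / tau) f" if "f \<in> dual_system penrose_system i j" for i j f
      using that similarity_sharp_penrose_maps by (cases i; cases j) (auto simp: dual_system_def)
    \<comment> \<open>The acute triangle is read as \<open>tr\<close>, \<open>tp\<close>,
      \<open>tq\<close> to fit the common cutting pattern: measured from \<open>tr\<close> instead
      of \<open>tp\<close>, the cut ratio \<open>1 / tau\<close> becomes \<open>1 - 1 / tau\<close>,
      which is \<open>1 / tau\<^sup>2\<close>.\<close>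
    show "?r = tr + of_real (1 / tau\<^sup>2) * (tp - tr)"
      unfolding of_real_inverse_tau of_real_inverse_tau_square by (simp add: algebra_simps)
    have inj: "f x \<noteq> f y" if "similarity (1 / tau) f" "x \<noteq> y" for f x y
      using similarity_bij [OF that(1)] tau_pos that(2) by (auto dest: bij_is_inj injD)
    have ne: "tr \<noteq> tp" "tr \<noteq> tq" "tc \<noteq> ta"
      using tuebingen_not_collinear tuebingen_triangles by (auto simp: acute_def)
    \<comment> \<open>In each case both points are images of two distinct vertices under one dual
      map, so injectivity separates them.\<close>
    show "?r \<noteq> tq" "?q \<noteq> ?r" "?s \<noteq> tc"
      using inj [OF similarity_sharp_penrose_maps(3) ne(1)]
        inj [OF similarity_sharp_penrose_maps(5) ne(2)]
        inj [OF similarity_sharp_penrose_maps(1) ne(3)]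
      by (simp_all only: dual_maps_at_vertices not_False_eq_True)
    show "tuebingen_tiles tp tq tr ta tb tc Large = convex hull {tr, tp, tq}"
      by (simp add: insert_commute)
  qed (auto simp: dual_system_def dual_maps_at_vertices simp del: of_real_divide of_real_power)
qed

lemma rigid_dual_penrose: "rigid (dual_system penrose_system)"
proof -
  have "tq \<noteq> tp" using tuebingen_not_collinear by auto
  then show ?thesis
    unfolding rigid_def
    using over_Q_xi_dual [OF over_Q_xi_penrose] similarity_sharp_penrose_maps
      dual_maps_at_vertices(1,4)
    by (auto simp: dual_system_def)
qed

section \<open>Duals of whole classes of representatives\<close>

lemma penrose_eq: "penrose = {F. same_substitution penrose_system F}"
proof -
  have "\<exists>X. tile_substitution F X" if "same_substitution penrose_system F" for F
    using that tile_substitution_transport [OF tile_substitution_penrose]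
    unfolding same_substitution_iff by blast
  then show ?thesis unfolding penrose_def by blast
qed

text \<open>One inclusion takes \<open>P\<close> itself as the representative; the other needs
  rigidity, which makes the duals of all other representatives over the field equivalent to that of
  \<open>P\<close>.\<close>

lemma star_dual_eq:
  assumes "rigid P"
  shows "star_dual {F. same_substitution P F} = {G. same_substitution (dual_system P) G}"
proof -
  have "over_Q_xi P" using assms by (simp add: rigid_def)
  then show ?thesis
    unfolding star_dual_def
    using same_substitution_dual [OF assms] same_substitution_refl same_substitution_trans by blast
qed

theorem theorem3p1:
  "penrose_system \<in> penrose \<and> star_dual penrose = tuebingen \<and> star_dual tuebingen = penrose"
proof -
  let ?T = "dual_system penrose_system"
  have tuebingen: "tuebingen = {G. same_substitution ?T G}"
    unfolding dual_penrose_eq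
    using tuebingen_eq [OF tuebingen_triangles] tile_substitution_dual_penrose
    unfolding dual_penrose_eq .
  have "same_substitution (dual_system ?T) penrose_system"
    by (rule same_substitution_dual_dual [OF over_Q_xi_penrose])
  then have "{G. same_substitution (dual_system ?T) G} = {G. same_substitution penrose_system G}"
    using same_substitution_sym same_substitution_trans by blast
  then show ?thesis
    using star_dual_eq [OF rigid_penrose] star_dual_eq [OF rigid_dual_penrose]
    by (simp add: penrose_eq tuebingen same_substitution_refl)
qed

end
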